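(* Let $\Gamma$ be a finitely generated group with finite symmetric generating set $S$, and let $\Delta$ be the Laplace operator of the uniform probability measure on $S$, with spectral distribution $N$. Assume there exists a sequence of finite subsets $(\Omega_n)_{n\ge1}$ of $\Gamma$ with the following properties: (1) There exists a constant $\alpha\ge1$ such that $\lambda_1(\Omega_n)\le\alpha/n^2$ for all $n$. (2) $|\Omega_n|<|\Omega_{n+1}|$ for all $n$. (3) There exists $C>1$ such that the piecewise linear extension $F:[1,\infty)\to\mathbb R$ of the function $n\mapsto|\Omega_n|$ satisfies $F(Cr)\ge F(r)^2$ for large $r>0$. Then, near zero, $$N(\lambda)\succeq\frac{1}{F(\lambda^{-1/2})}.$$
   Context: Let $\mu=\frac1{|S|}\sum_{s\in S}\delta_s$, $R_\mu:l^2(\Gamma)\to l^2(\Gamma)$, $R_\mu(f)(x)=\sum_{\gamma}f(x\gamma^{-1})\mu(\gamma)$, and $\Delta=\mathrm{id}-R_\mu$. The spectral distribution is $N(\lambda)=\langle\chi_{(-\infty,\lambda]}(\Delta)\delta_e,\delta_e\rangle_{l^2(\Gamma)}$ for $\lambda\ge0$. For a finite non-empty subset $\Omega\subset\Gamma$, $\lambda_1(\Omega)=\inf_{\emptyset\ne\mathrm{supp}(f)\subset\Omega}\langle\Delta f,f\rangle/\|f\|_2^2$. Asymptotic comparison: $f\preceq g$ near zero means there are $C',D,\epsilon>0$ with $f(\lambda)\le C'g(D\lambda)$ for all $\lambda\in[0,\epsilon)$; $f\succeq g$ means $g\preceq f$. An expression defined only for small $\lambda>0$ (such as $1/F(\lambda^{-1/2})$)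 is given the value $0$ at $\lambda=0$. *)

theory Defs
  imports "HOL-Analysis.Analysis" "HOL-Algebra.Generated_Groups"
begin

section \<open>The complex Hilbert space of square-summable functions\<close>

text \<open>Functions on \<open>X\<close> are represented by functions on the whole type that vanish outside \<open>X\<close>.
  The inner product is linear in the first argument.\<close>

definition ell2 :: "'a set \<Rightarrow> ('a \<Rightarrow> complex) set" where
  "ell2 X = {f. (\<forall>x. x \<notin> X \<longrightarrow> f x = 0) \<and> (\<lambda>x. (cmod (f x))\<^sup>2) summable_on X}"

definition ell2_inner :: "'a set \<Rightarrow> ('a \<Rightarrow> complex) \<Rightarrow> ('a \<Rightarrow> complex) \<Rightarrow> complex" where
  "ell2_inner X f g = (\<Sum>\<^sub>\<infinity>x\<in>X. f x * cnj (g x))"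

definition ell2_norm :: "'a set \<Rightarrow> ('a \<Rightarrow> complex) \<Rightarrow> real" where
  "ell2_norm X f = sqrt (\<Sum>\<^sub>\<infinity>x\<in>X. (cmod (f x))\<^sup>2)"

definition point_mass :: "'a \<Rightarrow> 'a \<Rightarrow> complex" where
  "point_mass x = (\<lambda>y. if y = x then 1 else 0)"

section \<open>Spectral measures and spectral projections\<close>

definition orthogonal_projection ::
    "'a set \<Rightarrow> (('a \<Rightarrow> complex) \<Rightarrow> ('a \<Rightarrow> complex)) \<Rightarrow> bool" where
  "orthogonal_projection X E \<longleftrightarrow>
     E \<in> ell2 X \<rightarrow> ell2 X \<and>
     (\<forall>f\<in>ell2 X. \<forall>g\<in>ell2 X. \<forall>a b.
        E (\<lambda>x. a * f x + b * g x) = (\<lambda>x. a * E f x + b * E g x)) \<and>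
     (\<forall>f\<in>ell2 X. E (E f) = E f) \<and>
     (\<forall>f\<in>ell2 X. \<forall>g\<in>ell2 X. ell2_inner X (E f) g = ell2_inner X f (E g))"

definition projection_valued_measure ::
    "'a set \<Rightarrow> (real set \<Rightarrow> ('a \<Rightarrow> complex) \<Rightarrow> ('a \<Rightarrow> complex)) \<Rightarrow> bool" where
  "projection_valued_measure X P \<longleftrightarrow>
     (\<forall>B\<in>sets borel. orthogonal_projection X (P B)) \<and>
     (\<forall>f\<in>ell2 X. P UNIV f = f) \<and>
     (\<forall>A\<in>sets borel. \<forall>B\<in>sets borel. \<forall>f\<in>ell2 X. P (A \<inter> B) f = P A (P B f)) \<and>
     (\<forall>A :: nat \<Rightarrow> real set. range A \<subseteq> sets borel \<longrightarrow> disjoint_family A \<longrightarrow>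
        (\<forall>f\<in>ell2 X. \<forall>g\<in>ell2 X.
           (\<lambda>i. ell2_inner X (P (A i) f) g) sums ell2_inner X (P (\<Union>i. A i) f) g))"

definition scalar_spectral_measure ::
    "'a set \<Rightarrow> (real set \<Rightarrow> ('a \<Rightarrow> complex) \<Rightarrow> ('a \<Rightarrow> complex)) \<Rightarrow> ('a \<Rightarrow> complex) \<Rightarrow> real measure" where
  "scalar_spectral_measure X P f =
     measure_of UNIV (sets borel) (\<lambda>B. ennreal (Re (ell2_inner X (P B f) f)))"

text \<open>\<open>P\<close> is the spectral measure of the bounded self-adjoint operator \<open>T\<close>, i.e.
  \<open>T = \<integral> t dP(t)\<close> with \<open>P\<close> compactly supported. It suffices to state the integral formula
  for the diagonal matrix coefficients: the space is complex, so the off-diagonal ones follow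
  by polarization.\<close>

definition is_spectral_measure ::
    "'a set \<Rightarrow> (('a \<Rightarrow> complex) \<Rightarrow> ('a \<Rightarrow> complex)) \<Rightarrow>
     (real set \<Rightarrow> ('a \<Rightarrow> complex) \<Rightarrow> ('a \<Rightarrow> complex)) \<Rightarrow> bool" where
  "is_spectral_measure X T P \<longleftrightarrow>
     projection_valued_measure X P \<and>
     (\<exists>K. compact K \<and> (\<forall>f\<in>ell2 X. P K f = f)) \<and>
     (\<forall>f\<in>ell2 X. ell2_inner X (T f) f =
        complex_of_real (\<integral>t. t \<partial>scalar_spectral_measure X P f))"

text \<open>The operator \<open>\<chi>\<^sub>B(T)\<close> of the Borel functional calculus, for Borel sets \<open>B\<close>. By the spectral
  theorem the spectral measure of a bounded self-adjoint \<open>T\<close> exists, and its values at Borel sets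
  are uniquely determined on \<open>ell2 X\<close>; the choice operator only affects irrelevant arguments.\<close>

definition spectral_projection ::
    "'a set \<Rightarrow> (('a \<Rightarrow> complex) \<Rightarrow> ('a \<Rightarrow> complex)) \<Rightarrow>
     real set \<Rightarrow> ('a \<Rightarrow> complex) \<Rightarrow> ('a \<Rightarrow> complex)" where
  "spectral_projection X T B = (SOME P. is_spectral_measure X T P) B"

section \<open>The Laplace operator of a group\<close>

definition uniform_weight :: "'a set \<Rightarrow> 'a \<Rightarrow> real" where
  "uniform_weight S \<gamma> = indicator S \<gamma> / real (card S)"

definition right_convolution ::
    "('a, 'b) monoid_scheme \<Rightarrow> ('a \<Rightarrow> real) \<Rightarrow> ('a \<Rightarrow> complex) \<Rightarrow> ('a \<Rightarrow> complex)" where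
  "right_convolution G \<mu> f = (\<lambda>x. if x \<in> carrier G
     then \<Sum>\<^sub>\<infinity>\<gamma>\<in>carrier G. f (x \<otimes>\<^bsub>G\<^esub> inv\<^bsub>G\<^esub> \<gamma>) * complex_of_real (\<mu> \<gamma>) else 0)"

definition laplace ::
    "('a, 'b) monoid_scheme \<Rightarrow> 'a set \<Rightarrow> ('a \<Rightarrow> complex) \<Rightarrow> ('a \<Rightarrow> complex)" where
  "laplace G S f = (\<lambda>x. f x - right_convolution G (uniform_weight S) f x)"

text \<open>In the next two definitions the inner products are real, since the Laplace operator of a
  symmetric set and its spectral projections are self-adjoint.\<close>

definition spectral_distribution ::
    "('a, 'b) monoid_scheme \<Rightarrow> 'a set \<Rightarrow> real \<Rightarrow> real" where
  "spectral_distribution G S t =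
     Re (ell2_inner (carrier G)
          (spectral_projection (carrier G) (laplace G S) {..t} (point_mass \<one>\<^bsub>G\<^esub>))
          (point_mass \<one>\<^bsub>G\<^esub>))"

definition lambda1 :: "('a, 'b) monoid_scheme \<Rightarrow> 'a set \<Rightarrow> 'a set \<Rightarrow> real" where
  "lambda1 G S \<Omega> =
     Inf {Re (ell2_inner (carrier G) (laplace G S f) f) / (ell2_norm (carrier G) f)\<^sup>2 | f.
            f \<in> ell2 (carrier G) \<and> {x. f x \<noteq> 0} \<noteq> {} \<and> {x. f x \<noteq> 0} \<subseteq> \<Omega>}"

section \<open>Piecewise linear extension and comparison near zero\<close>

text \<open>Only meaningful on \<open>[1,\<infinity>)\<close> for a sequence indexed by \<open>n \<ge> 1\<close>.\<close>

definition piecewise_linear :: "(nat \<Rightarrow> real) \<Rightarrow> real \<Rightarrow> real" where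
  "piecewise_linear a r =
     (let n = nat \<lfloor>r\<rfloor> in a n + (r - real n) * (a (Suc n) - a n))"

definition preceq_near_zero :: "(real \<Rightarrow> real) \<Rightarrow> (real \<Rightarrow> real) \<Rightarrow> bool" where
  "preceq_near_zero f g \<longleftrightarrow>
     (\<exists>C'>0. \<exists>D>0. \<exists>\<epsilon>>0. \<forall>t\<in>{0..<\<epsilon>}. f t \<le> C' * g (D * t))"

definition succeq_near_zero :: "(real \<Rightarrow> real) \<Rightarrow> (real \<Rightarrow> real) \<Rightarrow> bool" where
  "succeq_near_zero f g \<longleftrightarrow> preceq_near_zero g f"

end

theory Submission
  imports Defs "HOL-Probability.Helly_Selection" "HOL-Computational_Algebra.Polynomial"
begin

text \<open>Let \<open>P\<close> be the spectral measure of the Laplace operator \<open>\<Delta>\<close> and \<open>0 < a < b\<close>.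
  A function \<open>f\<close> supported on \<open>\<Omega>\<close> with Rayleigh quotient at most \<open>a / 2\<close> satisfies
  \<open>\<parallel>f\<parallel>\<^sup>2 \<le> 2 \<parallel>P {..a} f\<parallel>\<^sup>2\<close> by Markov's inequality, while expanding \<open>f\<close> in point masses gives
  \<open>\<parallel>P {..a} f\<parallel>\<^sup>2 \<le> card \<Omega> \<parallel>f\<parallel>\<^sup>2 max\<^sub>x \<parallel>P {..a} \<delta>\<^sub>x\<parallel>\<^sup>2\<close>. Left translations commute with \<open>\<Delta>\<close>,
  so \<open>\<parallel>P {..a} \<delta>\<^sub>x\<parallel> \<le> \<parallel>P {..b} \<delta>\<^sub>e\<parallel>\<close>; hence \<open>1 \<le> 2 card \<Omega> N(b)\<close>. Apply this to \<open>\<Omega>\<^sub>n\<close> with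
  \<open>n = \<lfloor>\<lambda> powr (-1/2)\<rfloor>\<close>.

  Since \<open>N\<close> is defined by choosing a spectral measure, its existence has to be shown first: for a
  self-adjoint \<open>0 \<le> A \<le> 1\<close>, the functional \<open>p \<mapsto> \<langle>p(A) f, f\<rangle>\<close> is nonnegative on the
  Bernstein polynomials and so is a moment functional of a measure \<open>\<mu>\<^sub>f\<close> on \<open>[0,1]\<close>, and
  \<open>P B f = lim p\<^sub>n(A) f\<close> for polynomials \<open>p\<^sub>n\<close> converging in \<open>L\<^sup>2(\<mu>\<^sub>f)\<close> to the indicator
  of \<open>B\<close>.\<close>

section \<open>The Hausdorff moment problem\<close>

text \<open>The operator behind \<open>spectral_distribution\<close> comes from a choice, so
  everything about it has to follow from \<open>is_spectral_measure\<close> alone. That predicate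
  describes the operator only through diagonal coefficients and says nothing about translations. The
  substitute is intrinsic: vectors in the range of \<open>P {..a}\<close> satisfy norm (T^n h) <= C
  a^n, left translations preserve this bound, and it excludes any component above \<open>b\<close>.
  The gap a < b is the price, and the dilation \<open>D\<close> in \<open>preceq_near_zero\<close>
  absorbs it. Existence is proved over a real inner product space. Complex linearity and invariance
  of the functions supported on the carrier come afterwards, from commutation with complex scalars
  and with restriction. The algebraic laws of the projections are obtained from diagonal values,
  since a symmetric operator with vanishing quadratic form is zero. Constants: a factor 4 from r <
  2n for n = floor r, a factor 2 from a / 2 in the energy bound and a factor 2 for the gap give D =
  16 alpha; the constant C' = 2 is the loss in norm in Markov's inequality.\<close>

lemma binomial_ratio_diff_le:
  fixes k n :: nat
  assumes "k \<le> n" "j \<le> n" "0 < n"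
  shows "\<bar>real (k choose j) / real (n choose j) - (real k / real n) ^ j\<bar> \<le> (real j)\<^sup>2 / real n"
  using \<open>j \<le> n\<close>
proof (induction j)
  case 0
  show ?case by simp
next
  case (Suc j)
  define x where "x = real k / real n"
  define a where "a = real (k choose j) / real (n choose j)"
  have jn: "j < n" using Suc.prems by simp
  have x01: "0 \<le> x" "x \<le> 1" using assms by (auto simp: x_def)
  have a01: "0 \<le> a" "a \<le> 1"
    using binomial_right_mono[OF \<open>k \<le> n\<close>, of j] jn
    by (auto simp: a_def divide_le_eq_1 binomial_eq_0_iff)
  have IH: "\<bar>a - x ^ j\<bar> \<le> (real j)\<^sup>2 / real n"
    using Suc by (simp add: a_def x_def)
  have step: "real (m choose Suc j) = real (m choose j) * (real m - real j) / real (Suc j)" for m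
  proof (cases "j \<le> m")
    case True
    have "Suc j * (m choose Suc j) = (m choose j) * (m - j)"
      by (metis binomial_absorb_comp binomial_absorption mult.commute)
    then have "real (Suc j) * real (m choose Suc j) = real (m choose j) * (real m - real j)"
      using True by (metis of_nat_mult of_nat_diff)
    then show ?thesis by (simp add: field_simps)
  qed (simp add: binomial_eq_0)
  have rec: "real (k choose Suc j) / real (n choose Suc j)
      = a * ((real k - real j) / (real n - real j))"
    unfolding a_def step by simp
  have first: "\<bar>a * ((real k - real j) / (real n - real j) - x)\<bar> \<le> real j / real n"
  proof (cases "j \<le> k")
    case True
    have "x - (real k - real j) / (real n - real j) = real j * (real n - real k) / (real n * (real n - real j))"
      using jn assms by (simp add: x_def field_simps)
    also have "\<dots> = (real j / real n) * ((real n - real k) / (real n - real j))"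
      by simp
    finally have eq: "\<bar>(real k - real j) / (real n - real j) - x\<bar>
        = (real j / real n) * ((real n - real k) / (real n - real j))"
      using jn assms by (subst abs_minus_commute) (simp add: abs_of_nonneg)
    have "\<dots> \<le> (real j / real n) * 1"
      using True jn by (intro mult_left_mono) (auto simp: divide_le_eq_1)
    then have "\<bar>(real k - real j) / (real n - real j) - x\<bar> \<le> real j / real n"
      using eq by simp
    then have "a * \<bar>(real k - real j) / (real n - real j) - x\<bar> \<le> 1 * (real j / real n)"
      using a01 by (intro mult_mono) auto
    then show ?thesis using a01 by (simp add: abs_mult)
  qed (simp add: a_def binomial_eq_0)
  \<comment> \<open>Telescoping over the factors of both products: the new factor contributes at
    most j/n because a <= 1, and the earlier error is only multiplied by x <= 1.\<close>
  have "a * ((real k - real j) / (real n - real j)) - x ^ Suc j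
      = a * ((real k - real j) / (real n - real j) - x) + x * (a - x ^ j)"
    by (simp add: algebra_simps)
  moreover have "\<bar>x * (a - x ^ j)\<bar> \<le> 1 * ((real j)\<^sup>2 / real n)"
    unfolding abs_mult using x01 IH by (intro mult_mono) auto
  ultimately have "\<bar>a * ((real k - real j) / (real n - real j)) - x ^ Suc j\<bar>
      \<le> real j / real n + (real j)\<^sup>2 / real n"
    using first by linarith
  also have "\<dots> = (real j + (real j)\<^sup>2) / real n" by (simp add: add_divide_distrib)
  also have "\<dots> \<le> (real (Suc j))\<^sup>2 / real n"
    by (intro divide_right_mono) (auto simp: power2_eq_square algebra_simps)
  finally show ?case using rec by (simp add: x_def)
qed

definition bernstein_poly :: "nat \<Rightarrow> nat \<Rightarrow> real poly" where
  "bernstein_poly n k = smult (real (n choose k)) ([:0, 1:] ^ k * [:1, -1:] ^ (n - k))"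

text \<open>The weight is a version of (k/n)^j without replacement, chosen to make the identity
  exact: (n choose k)(k choose j) = (n choose j)(n-j choose k-j), so X^j factors out and the
  binomial theorem for X + (1 - X) remains. \<open>binomial_ratio_diff_le\<close> measures the
  distance of the weight from (k/n)^j.\<close>

lemma sum_binomial_weighted_bernstein:
  assumes "j \<le> n"
  shows "(\<Sum>k\<le>n. smult (real (k choose j) / real (n choose j)) (bernstein_poly n k)) = [:0, 1:] ^ j"
proof -
  let ?X = "[:0, 1:] :: real poly" and ?Y = "[:1, -1:] :: real poly"
  have "(\<Sum>k\<le>n. smult (real (k choose j) / real (n choose j)) (bernstein_poly n k))
      = (\<Sum>k=j..n. smult (real (k choose j) / real (n choose j)) (bernstein_poly n k))"
    by (intro sum.mono_neutral_right) (auto simp: binomial_eq_0)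
  also have "\<dots> = (\<Sum>k=j..n. smult (real ((n - j) choose (k - j))) (?X ^ k * ?Y ^ (n - k)))"
  proof (intro sum.cong refl)
    fix k assume k: "k \<in> {j..n}"
    have "(n choose k) * (k choose j) = (n choose j) * ((n - j) choose (k - j))"
      using k by (intro choose_mult) auto
    then have "real (n choose k) * real (k choose j) = real (n choose j) * real ((n - j) choose (k - j))"
      by (metis of_nat_mult)
    moreover have "real (n choose j) \<noteq> 0" using assms by (simp add: binomial_eq_0_iff)
    ultimately have "real (k choose j) / real (n choose j) * real (n choose k) = real ((n - j) choose (k - j))"
      by (simp add: field_simps)
    then show "smult (real (k choose j) / real (n choose j)) (bernstein_poly n k)
        = smult (real ((n - j) choose (k - j))) (?X ^ k * ?Y ^ (n - k))"
      by (simp add: bernstein_poly_def)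
  qed
  also have "\<dots> = (\<Sum>i\<le>n - j. smult (real ((n - j) choose i)) (?X ^ (i + j) * ?Y ^ (n - (i + j))))"
    by (rule sum.reindex_bij_witness[of _ "\<lambda>i. i + j" "\<lambda>k. k - j"]) (use assms in auto)
  also have "\<dots> = ?X ^ j * (\<Sum>i\<le>n - j. of_nat ((n - j) choose i) * ?X ^ i * ?Y ^ (n - j - i))"
    unfolding sum_distrib_left
    by (intro sum.cong refl) (simp add: power_add of_nat_poly algebra_simps)
  also have "\<dots> = ?X ^ j * (?X + ?Y) ^ (n - j)"
    by (subst binomial_ring) simp
  also have "?X + ?Y = 1" by (simp add: one_pCons)
  finally show ?thesis by simp
qed

lemma borel_measurable_poly [measurable]: "poly (p :: real poly) \<in> borel_measurable borel"
  by (intro borel_measurable_continuous_onI continuous_on_poly continuous_on_id)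

lemma sum_bernstein_poly: "(\<Sum>k\<le>n. bernstein_poly n k) = 1"
  using sum_binomial_weighted_bernstein[of 0 n] by simp

text \<open>The masses L(b_{n,k}) at the points k/n form probability measures on [0,1] whose moments
  tend to L(X^j). Helly's theorem gives a weak limit along a subsequence, and its moments are these
  limits.\<close>

theorem hausdorff_moment:
  fixes L :: "real poly \<Rightarrow> real"
  assumes add: "\<And>p q. L (p + q) = L p + L q"
    and smult: "\<And>c p. L (smult c p) = c * L p"
    and pos: "\<And>k l. 0 \<le> L ([:0, 1:] ^ k * [:1, -1:] ^ l)"
    and one: "L 1 = 1"
  obtains M where "prob_space M" "sets M = sets borel" "AE t in M. t \<in> {0..1}"
    "\<And>p. (\<integral>t. poly p t \<partial>M) = L p"
proof -
  have L0: "L 0 = 0" using smult[of 0 0] by simp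
  have Lsum: "L (sum g I) = (\<Sum>i\<in>I. L (g i))" if "finite I" for g :: "nat \<Rightarrow> real poly" and I
    using that by (induction I rule: finite_induct) (auto simp: L0 add)
  define w where "w n k = L (bernstein_poly n k)" for n k
  have w_nonneg: "0 \<le> w n k" for n k
    unfolding w_def bernstein_poly_def smult using pos by simp
  have w_sum: "(\<Sum>k\<le>n. w n k) = 1" for n
    unfolding w_def using Lsum[of "{..n}" "bernstein_poly n"] by (simp add: sum_bernstein_poly one)
  define N where "N n = point_measure {..n} (\<lambda>k. ennreal (w n k))" for n
  define \<mu> where "\<mu> n = distr (N n) borel (\<lambda>k. real k / real n)" for n
  have meas: "(\<lambda>k. real k / real n) \<in> measurable (N n) borel" for n
    by (simp add: N_def)
  have prob_N: "prob_space (N n)" for n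
    unfolding N_def
    by (intro prob_space_point_measure) (auto simp: w_nonneg w_sum sum_ennreal)
  have distr\<mu>: "real_distribution (\<mu> n)" for n
    unfolding \<mu>_def by (intro prob_space.real_distribution_distr prob_N meas)
  have int\<mu>: "(\<integral>t. g t \<partial>\<mu> n) = (\<Sum>k\<le>n. w n k * g (real k / real n))"
    if "g \<in> borel_measurable borel" for g :: "real \<Rightarrow> real" and n
    unfolding \<mu>_def using that
    by (subst integral_distr[OF meas])
      (auto simp: N_def lebesgue_integral_point_measure_finite w_nonneg)
  \<comment> \<open>The left end is -1 and not 0 because \<open>tight\<close> uses intervals open on
    the left and there may be an atom at 0.\<close>
  have mass: "measure (\<mu> n) {-1<..1} = 1" for n
  proof -
    interpret \<mu>: real_distribution "\<mu> n" by (rule distr\<mu>)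
    have "measure (\<mu> n) {-1<..1} = (\<integral>t. indicator {-1<..1} t \<partial>\<mu> n)"
      by simp
    also have "\<dots> = (\<Sum>k\<le>n. w n k * indicator {-1<..1} (real k / real n))"
      by (rule int\<mu>) simp
    also have "\<dots> = (\<Sum>k\<le>n. w n k)"
    proof (intro sum.cong refl)
      fix k assume "k \<in> {..n}"
      then have "-1 < real k / real n" "real k / real n \<le> 1"
        by (auto simp: divide_le_eq_1 intro: less_le_trans[of _ 0])
      then show "w n k * indicator {-1<..1} (real k / real n) = w n k" by simp
    qed
    finally show ?thesis by (simp add: w_sum)
  qed
  have "\<exists>a b. a < b \<and> (\<forall>n. measure (\<mu> n) {a<..b} > 1 - \<epsilon>)" if "0 < \<epsilon>" for \<epsilon>
    by (rule exI[of _ "-1"], rule exI[of _ 1]) (simp add: mass that)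
  then have "tight \<mu>"
    unfolding tight_def using distr\<mu> by blast
  then obtain r M where r: "strict_mono (r :: nat \<Rightarrow> nat)" and M: "real_distribution M"
      and conv: "weak_conv_m (\<lambda>n. \<mu> (r n)) M"
    using tight_imp_convergent_subsubsequence[of \<mu> id] by (auto simp: strict_mono_id o_def)
  interpret M: real_distribution M by (rule M)
  \<comment> \<open>Weak convergence tests bounded continuous functions, so powers of t are replaced
    by powers of \<open>clamp t\<close>, which agree with them on [0,1]. Pushing the limit forward
    along \<open>clamp\<close> also forces its support into [0,1].\<close>
  define clamp :: "real \<Rightarrow> real" where "clamp t = max 0 (min 1 t)" for t
  have clamp_cont: "isCont clamp x" for x
    unfolding clamp_def[abs_def] by (intro continuous_intros)
  have clamp_meas[measurable]: "clamp \<in> borel_measurable borel"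
    by (intro borel_measurable_continuous_onI continuous_at_imp_continuous_on) (simp add: clamp_cont)
  have clamp01: "0 \<le> clamp t" "clamp t \<le> 1" for t by (auto simp: clamp_def)
  have "(\<lambda>n. \<integral>t. clamp t ^ j \<partial>(\<mu> (r n))) \<longlonglongrightarrow> (\<integral>t. clamp t ^ j \<partial>M)" for j
    by (rule weak_conv_imp_integral_bdd_continuous_conv[where B=1])
      (auto intro!: distr\<mu> M conv continuous_intros clamp_cont simp: power_abs clamp01 power_le_one)
  moreover have "(\<lambda>n. \<integral>t. clamp t ^ j \<partial>(\<mu> n)) \<longlonglongrightarrow> L ([:0, 1:] ^ j)" for j
  proof (rule LIM_zero_cancel, rule Lim_null_comparison)
    show "(\<lambda>n. (real j)\<^sup>2 / real n) \<longlonglongrightarrow> 0" by real_asymp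
    show "\<forall>\<^sub>F n in sequentially. norm ((\<integral>t. clamp t ^ j \<partial>(\<mu> n)) - L ([:0, 1:] ^ j)) \<le> (real j)\<^sup>2 / real n"
      \<comment> \<open>\<open>Suc j\<close> gives both j <= n and n > 0.\<close>
      using eventually_ge_at_top[of "Suc j"]
    proof eventually_elim
      fix n assume n: "Suc j \<le> n"
      have "(\<integral>t. clamp t ^ j \<partial>(\<mu> n)) = (\<Sum>k\<le>n. w n k * clamp (real k / real n) ^ j)"
        by (rule int\<mu>) simp
      also have "\<dots> = (\<Sum>k\<le>n. w n k * (real k / real n) ^ j)"
      proof (intro sum.cong refl)
        fix k assume "k \<in> {..n}"
        then have "real k / real n \<le> 1" using n by simp
        then show "w n k * clamp (real k / real n) ^ j = w n k * (real k / real n) ^ j"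
          by (simp add: clamp_def)
      qed
      finally have a: "(\<integral>t. clamp t ^ j \<partial>(\<mu> n)) = (\<Sum>k\<le>n. w n k * (real k / real n) ^ j)" .
      have b: "L ([:0, 1:] ^ j) = (\<Sum>k\<le>n. w n k * (real (k choose j) / real (n choose j)))"
        unfolding sum_binomial_weighted_bernstein[of j n, symmetric, OF Suc_leD[OF n]]
        by (subst Lsum) (auto simp: smult w_def mult_ac)
      have "norm ((\<integral>t. clamp t ^ j \<partial>(\<mu> n)) - L ([:0, 1:] ^ j))
          = \<bar>\<Sum>k\<le>n. w n k * ((real k / real n) ^ j - real (k choose j) / real (n choose j))\<bar>"
        unfolding a b by (simp add: sum_subtractf right_diff_distrib)
      also have "\<dots> \<le> (\<Sum>k\<le>n. w n k * ((real j)\<^sup>2 / real n))"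
      proof (intro order_trans[OF sum_abs] sum_mono)
        fix k assume "k \<in> {..n}"
        then have "\<bar>(real k / real n) ^ j - real (k choose j) / real (n choose j)\<bar> \<le> (real j)\<^sup>2 / real n"
          using binomial_ratio_diff_le[of k n j] n by (simp add: abs_minus_commute)
        then show "\<bar>w n k * ((real k / real n) ^ j - real (k choose j) / real (n choose j))\<bar>
            \<le> w n k * ((real j)\<^sup>2 / real n)"
          unfolding abs_mult using w_nonneg by (intro mult_mono) auto
      qed
      also have "\<dots> = (real j)\<^sup>2 / real n"
        unfolding sum_distrib_right[symmetric] w_sum by simp
      finally show "norm ((\<integral>t. clamp t ^ j \<partial>(\<mu> n)) - L ([:0, 1:] ^ j)) \<le> (real j)\<^sup>2 / real n" .
    qed
  qed
  ultimately have mom: "(\<integral>t. clamp t ^ j \<partial>M) = L ([:0, 1:] ^ j)" for j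
    using LIMSEQ_subseq_LIMSEQ[OF _ r, of "\<lambda>n. \<integral>t. clamp t ^ j \<partial>(\<mu> n)" "L ([:0, 1:] ^ j)"]
    by (auto simp: o_def intro: LIMSEQ_unique)
  show ?thesis
  proof
    show "prob_space (distr M borel clamp)" by (rule M.prob_space_distr) simp
    show "sets (distr M borel clamp) = sets borel" by simp
    show "AE t in distr M borel clamp. t \<in> {0..1}"
      by (subst AE_distr_iff) (auto simp: clamp01)
    fix p :: "real poly"
    have int: "integrable M (\<lambda>t. clamp t ^ i)" for i
      by (rule M.integrable_const_bound[where B=1]) (auto simp: power_abs clamp01 power_le_one)
    have "(\<integral>t. poly p t \<partial>distr M borel clamp) = (\<integral>t. poly p (clamp t) \<partial>M)"
      by (rule integral_distr) auto
    also have "\<dots> = (\<Sum>i\<le>degree p. coeff p i * (\<integral>t. clamp t ^ i \<partial>M))"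
      unfolding poly_altdef using int by (subst Bochner_Integration.integral_sum) auto
    also have "\<dots> = L (\<Sum>i\<le>degree p. smult (coeff p i) ([:0, 1:] ^ i))"
      by (subst Lsum) (auto simp: smult mom)
    also have "(\<Sum>i\<le>degree p. smult (coeff p i) ([:0, 1:] ^ i)) = p"
      by (metis (no_types, lifting) monom_altdef poly_as_sum_of_monoms sum.cong)
    finally show "(\<integral>t. poly p t \<partial>distr M borel clamp) = L p" .
  qed
qed

section \<open>Polynomial approximation of indicator functions\<close>

lemma poly_bounded_unit_interval:
  fixes p :: "real poly"
  obtains K where "\<And>t. t \<in> {0..1} \<Longrightarrow> \<bar>poly p t\<bar> \<le> K"
proof -
  have "compact (poly p ` {0..1})"
    by (intro compact_continuous_image continuous_intros) auto
  then have "bounded (poly p ` {0..1})" by (rule compact_imp_bounded)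
  then show ?thesis using that unfolding bounded_iff real_norm_def by blast
qed

text \<open>Measures on [0,1] are kept as Borel measures on the line with an almost-everywhere
  support condition; bounds on integrands then only have to hold on [0,1].\<close>

locale unit_interval_measure = finite_measure M for M :: "real measure" +
  assumes sets_borel [measurable_cong]: "sets M = sets borel"
    and AE_unit: "AE t in M. t \<in> {0..1}"
begin

lemma integrable_bounded:
  fixes f :: "real \<Rightarrow> real"
  assumes "f \<in> borel_measurable borel" "\<And>t. t \<in> {0..1} \<Longrightarrow> \<bar>f t\<bar> \<le> K"
  shows "integrable M f"
proof (rule integrable_const_bound)
  show "AE t in M. norm (f t) \<le> K" using AE_unit by eventually_elim (use assms in auto)
qed (use assms in simp)

lemma integrable_poly_mult:
  fixes h :: "real \<Rightarrow> real"
  assumes "h \<in> borel_measurable borel" "\<And>t. \<bar>h t\<bar> \<le> K"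
  shows "integrable M (\<lambda>t. poly p t * h t)"
proof -
  obtain L where "\<And>t. t \<in> {0..1} \<Longrightarrow> \<bar>poly p t\<bar> \<le> L"
    using poly_bounded_unit_interval[of p] by blast
  then show ?thesis
    using assms by (intro integrable_bounded[where K="L * K"])
      (auto simp: abs_mult intro!: mult_mono order_trans[OF abs_ge_zero])
qed

lemma integrable_poly: "integrable M (poly p)"
  using integrable_poly_mult[of "\<lambda>_. 1" 1 p] by simp

lemma integrable_poly_diff_square:
  fixes h :: "real \<Rightarrow> real"
  assumes "h \<in> borel_measurable borel" "\<And>t. \<bar>h t\<bar> \<le> K"
  shows "integrable M (\<lambda>t. (poly p t - h t)\<^sup>2)"
proof -
  have "integrable M (\<lambda>t. poly (p * p) t - 2 * (poly p t * h t) + (h t)\<^sup>2)"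
    using assms integrable_poly[of "p * p"]
    by (intro Bochner_Integration.integrable_add Bochner_Integration.integrable_diff
        integrable_poly integrable_mult_right integrable_poly_mult integrable_bounded[where K="K\<^sup>2"])
      (auto simp: abs_le_square_iff[symmetric] intro: order_trans[OF _ abs_ge_self])
  then show ?thesis by (simp add: power2_eq_square algebra_simps)
qed

end

text \<open>A family instead of one measure: additivity and symmetry of a spectral projection
  compare limits at several vectors, and these limits have to be taken along the same
  polynomials.\<close>

locale unit_interval_measures =
  fixes \<N> :: "real measure set"
  assumes finite_family: "finite \<N>"
    and unit_interval_measures: "\<And>M. M \<in> \<N> \<Longrightarrow> unit_interval_measure M"
begin

definition poly_approximable :: "(real \<Rightarrow> real) \<Rightarrow> bool" where
  "poly_approximable h \<longleftrightarrow> h \<in> borel_measurable borel \<and> (\<exists>K. \<forall>t. \<bar>h t\<bar> \<le> K) \<and>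
     (\<forall>e>0. \<exists>p. \<forall>M\<in>\<N>. (\<integral>t. (poly p t - h t)\<^sup>2 \<partial>M) < e)"

text \<open>Dominated convergence works measure by measure, and finiteness of the family yields one
  index \<open>n\<close> for all of them. The bounds e/4 match (x + y)^2 <= 2 x^2 + 2 y^2.\<close>

lemma poly_approximable_limit:
  assumes g: "\<And>n. poly_approximable (g n)" and bound: "\<And>n t. \<bar>g n t\<bar> \<le> K"
    and lim: "\<And>t. (\<lambda>n. g n t) \<longlonglongrightarrow> h t"
  shows "poly_approximable h"
  unfolding poly_approximable_def
proof (intro conjI allI impI)
  have [measurable]: "g n \<in> borel_measurable borel" for n
    using g by (auto simp: poly_approximable_def)
  show [measurable]: "h \<in> borel_measurable borel"
    by (rule borel_measurable_LIMSEQ_real[OF lim]) simp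
  have h_bound: "\<bar>h t\<bar> \<le> K" for t
    by (rule tendsto_upperbound[OF tendsto_rabs[OF lim]]) (auto simp: bound)
  then show "\<exists>K. \<forall>t. \<bar>h t\<bar> \<le> K" by blast
  fix e :: real assume "0 < e"
  have diff_bound: "(g n t - h t)\<^sup>2 \<le> 4 * K\<^sup>2" for n t
  proof -
    have "\<bar>g n t - h t\<bar> \<le> \<bar>2 * K\<bar>" using bound[of n t] h_bound[of t] by linarith
    then show ?thesis unfolding abs_le_square_iff by simp
  qed
  have "(\<lambda>n. \<integral>t. (g n t - h t)\<^sup>2 \<partial>M) \<longlonglongrightarrow> 0" if "M \<in> \<N>" for M
  proof -
    interpret unit_interval_measure M by (rule unit_interval_measures[OF that])
    have "(\<lambda>n. \<integral>t. (g n t - h t)\<^sup>2 \<partial>M) \<longlonglongrightarrow> (\<integral>t. 0 \<partial>M)"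
    proof (rule integral_dominated_convergence[where w="\<lambda>_. 4 * K\<^sup>2"])
      have "(\<lambda>n. (g n t - h t)\<^sup>2) \<longlonglongrightarrow> (h t - h t)\<^sup>2" for t
        by (intro tendsto_intros lim)
      then show "AE t in M. (\<lambda>n. (g n t - h t)\<^sup>2) \<longlonglongrightarrow> 0" by simp
    qed (auto simp: diff_bound)
    then show ?thesis by simp
  qed
  then have "\<forall>M\<in>\<N>. \<forall>\<^sub>F n in sequentially. (\<integral>t. (g n t - h t)\<^sup>2 \<partial>M) < e / 4"
    using \<open>0 < e\<close> by (intro ballI order_tendstoD(2)) auto
  then have "\<forall>\<^sub>F n in sequentially. \<forall>M\<in>\<N>. (\<integral>t. (g n t - h t)\<^sup>2 \<partial>M) < e / 4"
    using finite_family by (intro eventually_ball_finite) auto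
  then obtain n where n: "\<forall>M\<in>\<N>. (\<integral>t. (g n t - h t)\<^sup>2 \<partial>M) < e / 4"
    by (auto simp: eventually_sequentially)
  obtain p where p: "\<forall>M\<in>\<N>. (\<integral>t. (poly p t - g n t)\<^sup>2 \<partial>M) < e / 4"
    using g[of n] \<open>0 < e\<close> unfolding poly_approximable_def by (meson divide_pos_pos zero_less_numeral)
  have "(\<integral>t. (poly p t - h t)\<^sup>2 \<partial>M) < e" if "M \<in> \<N>" for M
  proof -
    interpret unit_interval_measure M by (rule unit_interval_measures[OF that])
    have i1: "integrable M (\<lambda>t. (poly p t - g n t)\<^sup>2)"
      by (rule integrable_poly_diff_square[OF _ bound]) simp
    have i2: "integrable M (\<lambda>t. (g n t - h t)\<^sup>2)"
      by (rule integrable_bounded[where K="4 * K\<^sup>2"]) (auto simp: diff_bound)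
    have "(\<integral>t. (poly p t - h t)\<^sup>2 \<partial>M) \<le> (\<integral>t. 2 * (poly p t - g n t)\<^sup>2 + 2 * (g n t - h t)\<^sup>2 \<partial>M)"
    proof (rule integral_mono)
      show "integrable M (\<lambda>t. (poly p t - h t)\<^sup>2)"
        by (rule integrable_poly_diff_square[OF _ h_bound]) simp
      fix t
      have "0 \<le> ((poly p t - g n t) - (g n t - h t))\<^sup>2" by simp
      then show "(poly p t - h t)\<^sup>2 \<le> 2 * (poly p t - g n t)\<^sup>2 + 2 * (g n t - h t)\<^sup>2"
        by (simp add: power2_eq_square algebra_simps)
    qed (use i1 i2 in auto)
    also have "\<dots> = 2 * (\<integral>t. (poly p t - g n t)\<^sup>2 \<partial>M) + 2 * (\<integral>t. (g n t - h t)\<^sup>2 \<partial>M)"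
      using i1 i2 by simp
    also have "\<dots> < e" using n p that \<open>0 < e\<close> by fastforce
    finally show ?thesis .
  qed
  then show "\<exists>p. \<forall>M\<in>\<N>. (\<integral>t. (poly p t - h t)\<^sup>2 \<partial>M) < e" by blast
qed

lemma poly_approximable_add:
  assumes "poly_approximable g" "poly_approximable h"
  shows "poly_approximable (\<lambda>t. g t + h t)"
  unfolding poly_approximable_def
proof (intro conjI allI impI)
  have [measurable]: "g \<in> borel_measurable borel" "h \<in> borel_measurable borel"
    using assms by (auto simp: poly_approximable_def)
  show "(\<lambda>t. g t + h t) \<in> borel_measurable borel" by simp
  obtain K L where bounds: "\<And>t. \<bar>g t\<bar> \<le> K" "\<And>t. \<bar>h t\<bar> \<le> L"
    using assms unfolding poly_approximable_def by metis
  have sum_bound: "\<bar>g t + h t\<bar> \<le> K + L" for t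
    using bounds[of t] by linarith
  then show "\<exists>K. \<forall>t. \<bar>g t + h t\<bar> \<le> K" by blast
  fix e :: real assume "0 < e"
  then have "0 < e / 4" by simp
  then obtain p q where pq: "\<forall>M\<in>\<N>. (\<integral>t. (poly p t - g t)\<^sup>2 \<partial>M) < e / 4"
      "\<forall>M\<in>\<N>. (\<integral>t. (poly q t - h t)\<^sup>2 \<partial>M) < e / 4"
    using assms unfolding poly_approximable_def by blast
  have "(\<integral>t. (poly (p + q) t - (g t + h t))\<^sup>2 \<partial>M) < e" if "M \<in> \<N>" for M
  proof -
    interpret unit_interval_measure M by (rule unit_interval_measures[OF that])
    have i1: "integrable M (\<lambda>t. (poly p t - g t)\<^sup>2)"
      by (rule integrable_poly_diff_square[OF _ bounds(1)]) simp
    have i2: "integrable M (\<lambda>t. (poly q t - h t)\<^sup>2)"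
      by (rule integrable_poly_diff_square[OF _ bounds(2)]) simp
    have "(\<integral>t. (poly (p + q) t - (g t + h t))\<^sup>2 \<partial>M)
        \<le> (\<integral>t. 2 * (poly p t - g t)\<^sup>2 + 2 * (poly q t - h t)\<^sup>2 \<partial>M)"
    proof (rule integral_mono)
      show "integrable M (\<lambda>t. (poly (p + q) t - (g t + h t))\<^sup>2)"
        by (rule integrable_poly_diff_square[OF _ sum_bound]) simp
      fix t
      have "0 \<le> ((poly p t - g t) - (poly q t - h t))\<^sup>2" by simp
      then show "(poly (p + q) t - (g t + h t))\<^sup>2 \<le> 2 * (poly p t - g t)\<^sup>2 + 2 * (poly q t - h t)\<^sup>2"
        by (simp add: power2_eq_square algebra_simps)
    qed (use i1 i2 in auto)
    also have "\<dots> = 2 * (\<integral>t. (poly p t - g t)\<^sup>2 \<partial>M) + 2 * (\<integral>t. (poly q t - h t)\<^sup>2 \<partial>M)"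
      using i1 i2 by simp
    also have "\<dots> < e" using pq that \<open>0 < e\<close> by fastforce
    finally show ?thesis .
  qed
  then show "\<exists>p. \<forall>M\<in>\<N>. (\<integral>t. (poly p t - (g t + h t))\<^sup>2 \<partial>M) < e" by blast
qed

lemma poly_approximable_continuous:
  assumes cont: "continuous_on UNIV h" and bound: "\<And>t. \<bar>h t\<bar> \<le> K"
  shows "poly_approximable h"
  unfolding poly_approximable_def
proof (intro conjI allI impI)
  show [measurable]: "h \<in> borel_measurable borel"
    using cont by (rule borel_measurable_continuous_onI)
  show "\<exists>K. \<forall>t. \<bar>h t\<bar> \<le> K" using bound by blast
  fix e :: real assume "0 < e"
  define m where "m = (\<Sum>M\<in>\<N>. measure M (space M))"
  have m: "measure M (space M) \<le> m" if "M \<in> \<N>" for M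
    unfolding m_def using that finite_family by (intro member_le_sum) auto
  have "0 \<le> m" unfolding m_def by (intro sum_nonneg) auto
  \<comment> \<open>\<open>m\<close> dominates each total mass, so a uniform error \<open>d\<close>
    costs at most m e / (m + 1) < e; the summand 1 covers m = 0.\<close>
  define d where "d = sqrt (e / (m + 1))"
  have d: "0 < d" "d\<^sup>2 = e / (m + 1)"
    using \<open>0 < e\<close> \<open>0 \<le> m\<close> by (auto simp: d_def)
  obtain q where q: "real_polynomial_function q" "\<And>t. t \<in> {0..1} \<Longrightarrow> \<bar>h t - q t\<bar> < d"
    using Stone_Weierstrass_real_polynomial_function[of "{0..1}" h d] d
      continuous_on_subset[OF cont] by auto
  obtain a n where a: "q = (\<lambda>x. \<Sum>i\<le>n. a i * x ^ i)"
    using q(1) real_polynomial_function_iff_sum by auto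
  define p where "p = (\<Sum>i\<le>n. monom (a i) i)"
  have p: "poly p t = q t" for t
    by (simp add: p_def a poly_sum poly_monom)
  have "(\<integral>t. (poly p t - h t)\<^sup>2 \<partial>M) < e" if "M \<in> \<N>" for M
  proof -
    interpret unit_interval_measure M by (rule unit_interval_measures[OF that])
    have "(\<integral>t. (poly p t - h t)\<^sup>2 \<partial>M) \<le> (\<integral>t. d\<^sup>2 \<partial>M)"
    proof (rule integral_mono_AE)
      show "integrable M (\<lambda>t. (poly p t - h t)\<^sup>2)"
        by (rule integrable_poly_diff_square[OF _ bound]) simp
      show "AE t in M. (poly p t - h t)\<^sup>2 \<le> d\<^sup>2"
        using AE_unit
      proof eventually_elim
        fix t :: real assume "t \<in> {0..1}"
        then have "\<bar>poly p t - h t\<bar> \<le> \<bar>d\<bar>"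
          using q(2)[of t] p[of t] by auto
        then show "(poly p t - h t)\<^sup>2 \<le> d\<^sup>2" by (simp add: abs_le_square_iff)
      qed
    qed simp
    also have "\<dots> = measure M (space M) * (e / (m + 1))" by (simp add: d(2))
    also have "\<dots> \<le> m * (e / (m + 1))"
      using m[OF that] \<open>0 < e\<close> \<open>0 \<le> m\<close> by (intro mult_right_mono) auto
    also have "\<dots> < e" using \<open>0 < e\<close> \<open>0 \<le> m\<close> by (simp add: field_simps)
    finally show ?thesis .
  qed
  then show "\<exists>p. \<forall>M\<in>\<N>. (\<integral>t. (poly p t - h t)\<^sup>2 \<partial>M) < e" by blast
qed

lemma poly_approximable_atMost: "poly_approximable (indicator {..a})"
proof (rule poly_approximable_limit[where K=1])
  \<comment> \<open>For n > 0 this is a ramp from 1 at \<open>a\<close> down to 0 at a + 1/n. It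
    descends to the right of \<open>a\<close>, so the limit is 1 at \<open>a\<close> itself.\<close>
  let ?g = "\<lambda>n t. max 0 (min 1 (1 - real n * (t - a)))"
  show "poly_approximable (?g n)" for n
    by (rule poly_approximable_continuous[where K=1]) (auto intro!: continuous_intros)
  show "\<bar>?g n t\<bar> \<le> 1" for n t by simp
  show "(\<lambda>n. ?g n t) \<longlonglongrightarrow> indicator {..a} t" for t
  proof (cases "t \<le> a")
    case True
    then have "?g n t = 1" for n
      by (simp add: max_def min_def mult_nonneg_nonpos)
    then show ?thesis using True by simp
  next
    case False
    have "\<forall>\<^sub>F n in sequentially. 1 / (t - a) \<le> real n"
      by (rule eventually_sequentiallyI[of "nat \<lceil>1 / (t - a)\<rceil>"]) linarith
    then have "\<forall>\<^sub>F n in sequentially. ?g n t = 0"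
      by eventually_elim (use False in \<open>auto simp: field_simps max_def min_def\<close>)
    then show ?thesis using False by (simp add: tendsto_eventually)
  qed
qed

text \<open>Dynkin induction over the half-lines, which are stable under intersection. Complements
  come from adding the constant 1 to a negative; for disjoint unions the partial sums stay bounded
  by 1, as \<open>poly_approximable_limit\<close> requires.\<close>

lemma poly_approximable_indicator:
  assumes "B \<in> sets borel"
  shows "poly_approximable (indicator B)"
proof -
  have "Int_stable (range (\<lambda>a::real. {..a}))"
    by (auto simp: Int_stable_def)
  moreover have "range (\<lambda>a::real. {..a}) \<subseteq> Pow UNIV" by simp
  moreover have "B \<in> sigma_sets UNIV (range (\<lambda>a::real. {..a}))"
    using assms unfolding borel_eq_atMost by simp
  ultimately show ?thesis
  proof (induction rule: sigma_sets_induct_disjoint)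
    case (basic A)
    then show ?case using poly_approximable_atMost by auto
  next
    case empty
    show ?case by (rule poly_approximable_continuous[where K=1]) auto
  next
    case (compl A)
    have neg: "poly_approximable (\<lambda>t. - indicator A t)"
      unfolding poly_approximable_def
    proof (intro conjI allI impI)
      show "(\<lambda>t. - indicator A t :: real) \<in> borel_measurable borel"
        using compl.IH by (auto simp: poly_approximable_def)
      show "\<exists>K. \<forall>t. \<bar>- indicator A t :: real\<bar> \<le> K" by (intro exI[of _ 1]) (simp add: indicator_def)
      fix e :: real assume "0 < e"
      then obtain p where p: "\<forall>M\<in>\<N>. (\<integral>t. (poly p t - indicator A t)\<^sup>2 \<partial>M) < e"
        using compl.IH unfolding poly_approximable_def by blast
      have "(poly (- p) t - - indicator A t)\<^sup>2 = (poly p t - indicator A t)\<^sup>2" for t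
        by (simp add: power2_eq_square algebra_simps)
      then show "\<exists>p. \<forall>M\<in>\<N>. (\<integral>t. (poly p t - - indicator A t)\<^sup>2 \<partial>M) < e"
        using p by (metis (no_types, lifting) Bochner_Integration.integral_cong)
    qed
    have "poly_approximable (\<lambda>t. 1 + - indicator A t)"
      by (rule poly_approximable_add[OF poly_approximable_continuous[where K=1] neg]) auto
    moreover have "(\<lambda>t. 1 + - indicator A t :: real) = indicator (UNIV - A)"
      by (auto simp: indicator_def)
    ultimately show ?case by simp
  next
    case (union A)
    have sum_ind: "(\<Sum>i<n. indicator (A i) t) = (indicator (\<Union>i<n. A i) t :: real)" for n t
      using union.hyps(1) by (intro indicator_UN_disjoint[symmetric])
        (auto simp: disjoint_family_on_def)
    show ?case
    proof (rule poly_approximable_limit[where K=1])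
      show "poly_approximable (\<lambda>t. \<Sum>i<n. indicator (A i) t)" for n
      proof (induction n)
        case 0
        show ?case by (simp add: poly_approximable_continuous[where K=0])
      next
        case (Suc n)
        then show ?case using poly_approximable_add[OF Suc union.IH[of n]] by simp
      qed
      show "\<bar>\<Sum>i<n. indicator (A i) t :: real\<bar> \<le> 1" for n t
        unfolding sum_ind by (simp add: indicator_def)
      show "(\<lambda>n. \<Sum>i<n. indicator (A i) t :: real) \<longlonglongrightarrow> indicator (\<Union>i. A i) t" for t
        unfolding sum_ind by (rule LIMSEQ_indicator_UN)
    qed
  qed
qed

end

section \<open>The spectral theorem for positive bounded operators\<close>

text \<open>Cauchy-Schwarz against the constant 1, read off from the nonnegative integral of (m x -
  c)^2, where m is the total mass and c the integral of x.\<close>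

lemma (in finite_measure) square_integral_le:
  fixes x :: "'a \<Rightarrow> real"
  assumes "integrable M x" "integrable M (\<lambda>t. (x t)\<^sup>2)"
  shows "(\<integral>t. x t \<partial>M)\<^sup>2 \<le> measure M (space M) * (\<integral>t. (x t)\<^sup>2 \<partial>M)"
proof (cases "measure M (space M) = 0")
  case True
  then have "emeasure M (space M) = 0" by (simp add: emeasure_eq_measure)
  then have "AE t in M. x t = 0"
    by (intro AE_I[of _ _ "space M"]) auto
  then have "(\<integral>t. x t \<partial>M) = 0" by (rule integral_eq_zero_AE)
  then show ?thesis using True by simp
next
  case False
  define m where "m = measure M (space M)"
  define c where "c = (\<integral>t. x t \<partial>M)"
  have "0 < m" using False by (simp add: m_def zero_less_measure_iff)
  have "0 \<le> (\<integral>t. (m * x t - c)\<^sup>2 \<partial>M)" by (rule Bochner_Integration.integral_nonneg) simp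
  also have "\<dots> = (\<integral>t. m\<^sup>2 * (x t)\<^sup>2 - 2 * m * c * x t + c\<^sup>2 \<partial>M)"
    by (intro Bochner_Integration.integral_cong refl) (simp add: power2_eq_square algebra_simps)
  also have "\<dots> = m\<^sup>2 * (\<integral>t. (x t)\<^sup>2 \<partial>M) - 2 * m * c * c + m * c\<^sup>2"
    using assms by (simp add: m_def c_def)
  also have "\<dots> = m * (m * (\<integral>t. (x t)\<^sup>2 \<partial>M) - c\<^sup>2)"
    by (simp add: power2_eq_square algebra_simps)
  finally have "0 \<le> m * (\<integral>t. (x t)\<^sup>2 \<partial>M) - c\<^sup>2"
    using \<open>0 < m\<close> by (simp add: zero_le_mult_iff)
  then show ?thesis by (simp add: m_def c_def)
qed

text \<open>On a finite measure, L^2 convergence gives convergence of integrals against a bounded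
  factor. The cases h = 1 and h = \<open>indicator B\<close> identify inner products of spectral
  projections with values of a measure.\<close>

lemma (in unit_interval_measure) integral_mult_approximation_tendsto_0:
  fixes h g :: "real \<Rightarrow> real" and p :: "nat \<Rightarrow> real poly"
  assumes [measurable]: "h \<in> borel_measurable borel" "g \<in> borel_measurable borel"
    and h: "\<And>t. \<bar>h t\<bar> \<le> 1" and g: "\<And>t. \<bar>g t\<bar> \<le> K"
    and lim: "(\<lambda>n. \<integral>t. (poly (p n) t - g t)\<^sup>2 \<partial>M) \<longlonglongrightarrow> 0"
  shows "(\<lambda>n. \<integral>t. h t * (poly (p n) t - g t) \<partial>M) \<longlonglongrightarrow> 0"
proof (rule Lim_null_comparison)
  let ?m = "measure M (space M)"
  have "(\<lambda>n. sqrt (?m * (\<integral>t. (poly (p n) t - g t)\<^sup>2 \<partial>M))) \<longlonglongrightarrow> sqrt (?m * 0)"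
    by (intro tendsto_intros lim)
  then show "(\<lambda>n. sqrt (?m * (\<integral>t. (poly (p n) t - g t)\<^sup>2 \<partial>M))) \<longlonglongrightarrow> 0" by simp
  show "\<forall>\<^sub>F n in sequentially. norm (\<integral>t. h t * (poly (p n) t - g t) \<partial>M)
      \<le> sqrt (?m * (\<integral>t. (poly (p n) t - g t)\<^sup>2 \<partial>M))"
  proof (rule always_eventually, rule allI)
    fix n
    have hg: "\<bar>h t * g t\<bar> \<le> K" for t
    proof -
      have "\<bar>h t\<bar> * \<bar>g t\<bar> \<le> 1 * K" by (intro mult_mono h g) auto
      then show ?thesis by (simp add: abs_mult)
    qed
    have h2: "(h t)\<^sup>2 \<le> 1" for t using h[of t] by (simp add: abs_square_le_1)
    have le: "(h t * (poly (p n) t - g t))\<^sup>2 \<le> (poly (p n) t - g t)\<^sup>2" for t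
      using mult_right_mono[OF h2[of t], of "(poly (p n) t - g t)\<^sup>2"]
      by (simp add: power_mult_distrib)
    have i2: "integrable M (\<lambda>t. (poly (p n) t - g t)\<^sup>2)"
      by (rule integrable_poly_diff_square[OF _ g]) simp
    have i3: "integrable M (\<lambda>t. (h t * (poly (p n) t - g t))\<^sup>2)"
      by (rule Bochner_Integration.integrable_bound[OF i2]) (auto simp: le)
    have "integrable M (\<lambda>t. poly (p n) t * h t - h t * g t)"
      by (intro Bochner_Integration.integrable_diff integrable_poly_mult[OF _ h]
          integrable_bounded[OF _ hg]) auto
    then have i1: "integrable M (\<lambda>t. h t * (poly (p n) t - g t))"
      by (simp add: algebra_simps)
    have "(\<integral>t. h t * (poly (p n) t - g t) \<partial>M)\<^sup>2 \<le> ?m * (\<integral>t. (h t * (poly (p n) t - g t))\<^sup>2 \<partial>M)"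
      by (rule square_integral_le[OF i1 i3])
    also have "\<dots> \<le> ?m * (\<integral>t. (poly (p n) t - g t)\<^sup>2 \<partial>M)"
      by (intro mult_left_mono integral_mono i2 i3 le) simp
    finally show "norm (\<integral>t. h t * (poly (p n) t - g t) \<partial>M)
        \<le> sqrt (?m * (\<integral>t. (poly (p n) t - g t)\<^sup>2 \<partial>M))"
      by (simp add: real_le_rsqrt)
  qed
qed

text \<open>Polarization at g = D f. Identities between symmetric operators, such as idempotence and
  additivity of projections, thereby reduce to equalities of quadratic forms.\<close>

lemma symmetric_zero_form_imp_zero:
  fixes D :: "'h::real_inner \<Rightarrow> 'h"
  assumes "linear D" "\<And>f g. D f \<bullet> g = f \<bullet> D g" "\<And>f. D f \<bullet> f = 0"
  shows "D f = 0"
proof -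
  have "D (f + g) \<bullet> (f + g) = D f \<bullet> f + D g \<bullet> g + 2 * (D f \<bullet> g)" for g
    using assms(2)[of g f] by (simp add: linear_add[OF assms(1)] inner_add inner_commute[of g])
  from this[of "D f"] have "D f \<bullet> D f = 0" by (simp add: assms(3))
  then show ?thesis by simp
qed

section \<open>Polynomial functional calculus and spectral projections of a positive
  contraction\<close>

locale positive_contraction =
  fixes A :: "'h::{real_inner,complete_space} \<Rightarrow> 'h"
  assumes linear_A: "linear A"
    and A_sym: "\<And>f g. A f \<bullet> g = f \<bullet> A g"
    and A_nonneg: "\<And>f. 0 \<le> A f \<bullet> f"
    and A_le: "\<And>f. A f \<bullet> f \<le> f \<bullet> f"
begin

definition poly_op :: "real poly \<Rightarrow> 'h \<Rightarrow> 'h" where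
  "poly_op p f = (\<Sum>i\<le>degree p. coeff p i *\<^sub>R (A ^^ i) f)"

lemma poly_op_upto:
  assumes "degree p \<le> n"
  shows "poly_op p f = (\<Sum>i\<le>n. coeff p i *\<^sub>R (A ^^ i) f)"
  unfolding poly_op_def using assms
  by (intro sum.mono_neutral_left) (auto simp: coeff_eq_0)

lemma poly_op_0 [simp]: "poly_op 0 f = 0"
  by (simp add: poly_op_def)

lemma poly_op_pCons [simp]: "poly_op (pCons a p) f = a *\<^sub>R f + A (poly_op p f)"
proof -
  have "poly_op (pCons a p) f = (\<Sum>i\<le>Suc (degree p). coeff (pCons a p) i *\<^sub>R (A ^^ i) f)"
    by (rule poly_op_upto) (rule degree_pCons_le)
  also have "\<dots> = a *\<^sub>R f + (\<Sum>i\<le>degree p. coeff p i *\<^sub>R A ((A ^^ i) f))"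
    by (subst sum.atMost_Suc_shift) simp
  also have "(\<Sum>i\<le>degree p. coeff p i *\<^sub>R A ((A ^^ i) f)) = A (poly_op p f)"
    unfolding poly_op_def by (simp add: linear_sum[OF linear_A] linear_scale[OF linear_A])
  finally show ?thesis .
qed

lemma poly_op_1 [simp]: "poly_op 1 f = f"
  by (simp add: one_pCons linear_0[OF linear_A])

lemma poly_op_add: "poly_op (p + q) f = poly_op p f + poly_op q f"
proof -
  let ?n = "max (degree p) (degree q)"
  have "degree (p + q) \<le> ?n" by (rule degree_add_le_max)
  then show ?thesis
    by (simp add: poly_op_upto[of _ ?n] sum.distrib scaleR_add_left)
qed

lemma poly_op_smult: "poly_op (smult c p) f = c *\<^sub>R poly_op p f"
  by (simp add: poly_op_upto[of _ "degree p"] scaleR_right.sum)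

lemma poly_op_diff: "poly_op (p - q) f = poly_op p f - poly_op q f"
  using poly_op_add[of p "- q" f] poly_op_smult[of "-1" q f] by simp

lemma poly_op_mult: "poly_op (p * q) f = poly_op p (poly_op q f)"
  by (induction p) (simp_all add: poly_op_add poly_op_smult)

lemma poly_op_commute:
  assumes "linear J" "\<And>f. J (A f) = A (J f)"
  shows "J (poly_op p f) = poly_op p (J f)"
  by (induction p) (simp_all add: linear_0 linear_add linear_scale assms)

lemma linear_poly_op: "linear (poly_op p)"
proof (induction p)
  case 0
  show ?case by (simp add: linear_iff)
next
  case (pCons a p)
  show ?case
    by (rule linearI) (simp_all add: linear_add linear_scale linear_A pCons.IH algebra_simps)
qed

lemma poly_op_sym: "poly_op p f \<bullet> g = f \<bullet> poly_op p g"
  by (induction p arbitrary: f g)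
    (simp_all add: inner_add A_sym poly_op_commute[OF linear_A refl])

lemma poly_op_mult_square_inner: "poly_op (q * q * r) f \<bullet> f = poly_op r (poly_op q f) \<bullet> poly_op q f"
proof -
  have "poly_op (q * q * r) f = poly_op q (poly_op r (poly_op q f))"
    by (metis mult.commute mult.left_commute poly_op_mult)
  then show ?thesis by (simp add: poly_op_sym)
qed

text \<open>Even powers split off as a square, which \<open>poly_op_mult_square_inner\<close> moves
  onto the vector. The remaining factor is 1, X, Y or XY, and X + Y = 1 gives XY = XXY + YYX, again
  squares times X or Y. This avoids square roots of operators.\<close>

lemma poly_op_bernstein_nonneg: "0 \<le> poly_op ([:0, 1:] ^ k * [:1, -1:] ^ l) f \<bullet> f"
proof -
  let ?X = "[:0, 1:] :: real poly" and ?Y = "[:1, -1:] :: real poly"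
  have X: "0 \<le> poly_op ?X f \<bullet> f" for f by (simp add: A_nonneg linear_0[OF linear_A])
  have Y: "0 \<le> poly_op ?Y f \<bullet> f" for f
    using A_le[of f] by (simp add: linear_0[OF linear_A] linear_neg[OF linear_A] inner_diff_left)
  have "?X * ?Y = ?X * ?X * ?Y + ?Y * ?Y * ?X" by simp
  then have XY: "0 \<le> poly_op (?X * ?Y) f \<bullet> f" for f
    by (simp only: poly_op_add poly_op_mult_square_inner inner_add_left) (intro add_nonneg_nonneg X Y)
  have "0 \<le> poly_op (?X ^ (k mod 2) * ?Y ^ (l mod 2)) f \<bullet> f" for f
    using X[of f] Y[of f] XY[of f]
    by (cases "even k"; cases "even l") (auto simp: even_iff_mod_2_eq_zero odd_iff_mod_2_eq_one)
  moreover have "?X ^ k * ?Y ^ l = (?X ^ (k div 2) * ?Y ^ (l div 2)) * (?X ^ (k div 2) * ?Y ^ (l div 2))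
      * (?X ^ (k mod 2) * ?Y ^ (l mod 2))"
  proof -
    have "?X ^ k = ?X ^ (k div 2) * ?X ^ (k div 2) * ?X ^ (k mod 2)"
      by (metis div_mult_mod_eq mult_2_right power_add)
    moreover have "?Y ^ l = ?Y ^ (l div 2) * ?Y ^ (l div 2) * ?Y ^ (l mod 2)"
      by (metis div_mult_mod_eq mult_2_right power_add)
    ultimately show ?thesis by (simp only: mult_ac)
  qed
  ultimately show ?thesis by (simp only: poly_op_mult_square_inner)
qed

text \<open>Dividing by the squared norm of f achieves L 1 = 1, as \<open>hausdorff_moment\<close>
  requires, and a constant density restores the mass. The zero vector gets the zero measure.\<close>

lemma spectral_measure_exists:
  "\<exists>M. unit_interval_measure M \<and> (\<forall>p. (\<integral>t. poly p t \<partial>M) = poly_op p f \<bullet> f)"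
proof (cases "f = 0")
  case True
  have "unit_interval_measure (null_measure borel)"
    by (intro unit_interval_measure.intro unit_interval_measure_axioms.intro finite_measureI) (auto intro!: AE_I[of _ _ UNIV])
  moreover have "(\<integral>t. poly p t \<partial>null_measure borel) = poly_op p f \<bullet> f" for p
    using True by simp
  ultimately show ?thesis by blast
next
  case False
  define c where "c = f \<bullet> f"
  have "0 < c" using False by (simp add: c_def)
  define L where "L p = (poly_op p f \<bullet> f) / c" for p
  have "L (p + q) = L p + L q" for p q
    by (simp add: L_def poly_op_add inner_add add_divide_distrib)
  moreover have "L (smult a p) = a * L p" for a p by (simp add: L_def poly_op_smult)
  moreover have "0 \<le> L ([:0, 1:] ^ k * [:1, -1:] ^ l)" for k l
    unfolding L_def using poly_op_bernstein_nonneg \<open>0 < c\<close> by simp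
  moreover have "L 1 = 1" using \<open>0 < c\<close> by (simp add: L_def c_def)
  ultimately obtain M where M: "prob_space M" "sets M = sets borel" "AE t in M. t \<in> {0..1}"
      "\<And>p. (\<integral>t. poly p t \<partial>M) = L p"
    using hausdorff_moment[of L] by blast
  interpret M: prob_space M by (rule M)
  let ?M = "density M (\<lambda>_. ennreal c)"
  have "unit_interval_measure ?M"
  proof (intro unit_interval_measure.intro unit_interval_measure_axioms.intro finite_measureI)
    show "sets ?M = sets borel" by (simp add: M)
    show "AE t in ?M. t \<in> {0..1}" by (subst AE_density) (use M(3) in auto)
    show "emeasure ?M (space ?M) \<noteq> \<infinity>"
      by (simp add: emeasure_density M.emeasure_space_1 nn_integral_cmult_indicator ennreal_mult_eq_top_iff)
  qed
  moreover have "(\<integral>t. poly p t \<partial>?M) = poly_op p f \<bullet> f" for p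
  proof -
    have [measurable]: "poly p \<in> borel_measurable M"
      using borel_measurable_poly[of p] by (simp add: measurable_cong_sets[OF M(2) refl])
    have "(\<integral>t. poly p t \<partial>?M) = (\<integral>t. c *\<^sub>R poly p t \<partial>M)"
      using \<open>0 < c\<close> by (intro integral_density) auto
    then show ?thesis using \<open>0 < c\<close> by (simp add: M(4) L_def)
  qed
  ultimately show ?thesis by blast
qed

definition spec_measure :: "'h \<Rightarrow> real measure" where
  "spec_measure f = (SOME M. unit_interval_measure M \<and> (\<forall>p. (\<integral>t. poly p t \<partial>M) = poly_op p f \<bullet> f))"

lemma spec_measure: "unit_interval_measure (spec_measure f)"
  and integral_poly_spec_measure: "(\<integral>t. poly p t \<partial>spec_measure f) = poly_op p f \<bullet> f"
  using someI_ex[OF spectral_measure_exists[of f]] unfolding spec_measure_def by blast+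

text \<open>The isometry from polynomials in L^2 of the spectral measure to the vectors p(A) f; it
  turns L^2 convergence of polynomials into convergence of vectors.\<close>

lemma norm_poly_op_square: "(norm (poly_op p f))\<^sup>2 = (\<integral>t. (poly p t)\<^sup>2 \<partial>spec_measure f)"
proof -
  have "(norm (poly_op p f))\<^sup>2 = poly_op (p * p) f \<bullet> f"
    by (simp add: poly_op_mult poly_op_sym power2_norm_eq_inner)
  then show ?thesis
    by (simp add: power2_eq_square flip: integral_poly_spec_measure)
qed

definition approximates :: "real set \<Rightarrow> 'h \<Rightarrow> (nat \<Rightarrow> real poly) \<Rightarrow> bool" where
  "approximates B f p \<longleftrightarrow> (\<lambda>n. \<integral>t. (poly (p n) t - indicator B t)\<^sup>2 \<partial>spec_measure f) \<longlonglongrightarrow> 0"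

lemma approximates_exists:
  assumes "finite V" "B \<in> sets borel"
  obtains p where "\<And>f. f \<in> V \<Longrightarrow> approximates B f p"
proof -
  interpret unit_interval_measures "spec_measure ` V"
    by (rule unit_interval_measures.intro) (use assms spec_measure in auto)
  have "\<exists>p. \<forall>f\<in>V. (\<integral>t. (poly p t - indicator B t)\<^sup>2 \<partial>spec_measure f) < inverse (real (Suc n))" for n
    using poly_approximable_indicator[OF assms(2)] unfolding poly_approximable_def by auto
  then obtain p where p: "\<And>n f. f \<in> V \<Longrightarrow>
      (\<integral>t. (poly (p n) t - indicator B t)\<^sup>2 \<partial>spec_measure f) < inverse (real (Suc n))"
    by metis
  have "approximates B f p" if "f \<in> V" for f
    unfolding approximates_def
    by (rule tendsto_sandwich[OF _ _ tendsto_const LIMSEQ_inverse_real_of_nat])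
      (auto intro!: always_eventually simp del: of_nat_Suc simp: less_imp_le[OF p[OF that]])
  then show ?thesis using that by blast
qed

text \<open>Both polynomials are compared with the indicator in L^2. For two members of one sequence
  this gives the Cauchy property, for two sequences the independence of the limit.\<close>

lemma norm_poly_op_diff_le:
  assumes [measurable]: "B \<in> sets borel"
  shows "(norm (poly_op p f - poly_op q f))\<^sup>2
     \<le> 2 * (\<integral>t. (poly p t - indicator B t)\<^sup>2 \<partial>spec_measure f)
       + 2 * (\<integral>t. (poly q t - indicator B t)\<^sup>2 \<partial>spec_measure f)"
proof -
  interpret unit_interval_measure "spec_measure f" by (rule spec_measure)
  have ind: "\<bar>indicator B t :: real\<bar> \<le> 1" for t by (simp add: indicator_def)
  have int: "integrable (spec_measure f) (\<lambda>t. (poly r t - indicator B t)\<^sup>2)" for r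
    by (rule integrable_poly_diff_square[OF _ ind]) simp
  have "(norm (poly_op p f - poly_op q f))\<^sup>2 = (\<integral>t. (poly (p - q) t)\<^sup>2 \<partial>spec_measure f)"
    by (simp add: norm_poly_op_square flip: poly_op_diff)
  also have "\<dots> \<le> (\<integral>t. 2 * (poly p t - indicator B t)\<^sup>2 + 2 * (poly q t - indicator B t)\<^sup>2 \<partial>spec_measure f)"
  proof (rule integral_mono)
    show "integrable (spec_measure f) (\<lambda>t. (poly (p - q) t)\<^sup>2)"
      using integrable_poly[of "(p - q) * (p - q)"] by (simp add: power2_eq_square poly_mult[abs_def])
    fix t
    have "0 \<le> ((poly p t - indicator B t) + (poly q t - indicator B t))\<^sup>2" by simp
    then show "(poly (p - q) t)\<^sup>2 \<le> 2 * (poly p t - indicator B t)\<^sup>2 + 2 * (poly q t - indicator B t)\<^sup>2"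
      by (simp add: power2_eq_square algebra_simps)
  qed (use int in auto)
  also have "\<dots> = 2 * (\<integral>t. (poly p t - indicator B t)\<^sup>2 \<partial>spec_measure f)
       + 2 * (\<integral>t. (poly q t - indicator B t)\<^sup>2 \<partial>spec_measure f)"
    using int by simp
  finally show ?thesis .
qed

lemma approximates_convergent:
  assumes "B \<in> sets borel" "approximates B f p"
  shows "\<exists>u. (\<lambda>n. poly_op (p n) f) \<longlonglongrightarrow> u"
proof -
  let ?e = "\<lambda>n. \<integral>t. (poly (p n) t - indicator B t)\<^sup>2 \<partial>spec_measure f"
  have "Cauchy (\<lambda>n. poly_op (p n) f)"
  proof (rule CauchyI)
    fix e :: real assume "0 < e"
    then have "\<forall>\<^sub>F n in sequentially. ?e n < e\<^sup>2 / 4"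
      using assms(2) unfolding approximates_def by (intro order_tendstoD(2)) auto
    then obtain N where N: "\<And>n. N \<le> n \<Longrightarrow> ?e n < e\<^sup>2 / 4"
      by (auto simp: eventually_sequentially)
    have "norm (poly_op (p m) f - poly_op (p n) f) < e" if "N \<le> m" "N \<le> n" for m n
    proof (rule power2_less_imp_less)
      show "(norm (poly_op (p m) f - poly_op (p n) f))\<^sup>2 < e\<^sup>2"
        using norm_poly_op_diff_le[OF assms(1), of "p m" f "p n"] N[OF that(1)] N[OF that(2)] by linarith
    qed (use \<open>0 < e\<close> in simp)
    then show "\<exists>M. \<forall>m\<ge>M. \<forall>n\<ge>M. norm (poly_op (p m) f - poly_op (p n) f) < e" by blast
  qed
  then show ?thesis by (simp add: Cauchy_convergent_iff convergent_def)
qed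

text \<open>The choice includes the approximating sequence; by \<open>spec_proj_tendsto\<close>
  every such sequence has this limit.\<close>

definition spec_proj :: "real set \<Rightarrow> 'h \<Rightarrow> 'h" where
  "spec_proj B f = (SOME u. \<exists>p. approximates B f p \<and> (\<lambda>n. poly_op (p n) f) \<longlonglongrightarrow> u)"

lemma spec_proj_tendsto:
  assumes B: "B \<in> sets borel" and p: "approximates B f p"
  shows "(\<lambda>n. poly_op (p n) f) \<longlonglongrightarrow> spec_proj B f"
proof -
  have "\<exists>u p. approximates B f p \<and> (\<lambda>n. poly_op (p n) f) \<longlonglongrightarrow> u"
    using approximates_convergent[OF assms] p by blast
  from someI_ex[OF this] obtain q where q: "approximates B f q"
    "(\<lambda>n. poly_op (q n) f) \<longlonglongrightarrow> spec_proj B f"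
    unfolding spec_proj_def by blast
  let ?e = "\<lambda>p n. \<integral>t. (poly (p n) t - indicator B t)\<^sup>2 \<partial>spec_measure f"
  have "(\<lambda>n. sqrt (2 * ?e p n + 2 * ?e q n)) \<longlonglongrightarrow> sqrt (2 * 0 + 2 * 0)"
    using p q(1) unfolding approximates_def by (intro tendsto_intros)
  then have "(\<lambda>n. sqrt (2 * ?e p n + 2 * ?e q n)) \<longlonglongrightarrow> 0" by simp
  then have "(\<lambda>n. poly_op (p n) f - poly_op (q n) f) \<longlonglongrightarrow> 0"
    by (rule Lim_null_comparison[rotated])
      (auto intro!: always_eventually real_le_rsqrt norm_poly_op_diff_le B)
  from tendsto_add[OF this q(2)] show ?thesis by simp
qed

lemma linear_spec_proj:
  assumes B: "B \<in> sets borel"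
  shows "linear (spec_proj B)"
proof (rule linearI)
  fix f g :: 'h and c :: real
  obtain p where p: "\<And>h. h \<in> {f, g, f + g} \<Longrightarrow> approximates B h p"
    using approximates_exists[of "{f, g, f + g}" B] B by auto
  have "(\<lambda>n. poly_op (p n) f + poly_op (p n) g) \<longlonglongrightarrow> spec_proj B f + spec_proj B g"
    using p by (intro tendsto_add spec_proj_tendsto B) auto
  moreover have "(\<lambda>n. poly_op (p n) f + poly_op (p n) g) \<longlonglongrightarrow> spec_proj B (f + g)"
    using spec_proj_tendsto[OF B, of "f + g" p] p by (simp add: linear_add[OF linear_poly_op])
  ultimately show "spec_proj B (f + g) = spec_proj B f + spec_proj B g"
    by (rule LIMSEQ_unique[symmetric])
  obtain q where q: "\<And>h. h \<in> {f, c *\<^sub>R f} \<Longrightarrow> approximates B h q"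
    using approximates_exists[of "{f, c *\<^sub>R f}" B] B by auto
  have "(\<lambda>n. c *\<^sub>R poly_op (q n) f) \<longlonglongrightarrow> c *\<^sub>R spec_proj B f"
    using q by (intro tendsto_intros spec_proj_tendsto B) auto
  moreover have "(\<lambda>n. c *\<^sub>R poly_op (q n) f) \<longlonglongrightarrow> spec_proj B (c *\<^sub>R f)"
    using spec_proj_tendsto[OF B, of "c *\<^sub>R f" q] q by (simp add: linear_scale[OF linear_poly_op])
  ultimately show "spec_proj B (c *\<^sub>R f) = c *\<^sub>R spec_proj B f"
    by (rule LIMSEQ_unique[symmetric])
qed

lemma spec_proj_sym:
  assumes B: "B \<in> sets borel"
  shows "spec_proj B f \<bullet> g = f \<bullet> spec_proj B g"
proof -
  obtain p where p: "\<And>h. h \<in> {f, g} \<Longrightarrow> approximates B h p"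
    using approximates_exists[of "{f, g}" B] B by auto
  have "(\<lambda>n. poly_op (p n) f \<bullet> g) \<longlonglongrightarrow> spec_proj B f \<bullet> g"
    using p by (intro tendsto_intros spec_proj_tendsto B) auto
  moreover have "(\<lambda>n. poly_op (p n) f \<bullet> g) \<longlonglongrightarrow> f \<bullet> spec_proj B g"
    unfolding poly_op_sym using p by (intro tendsto_intros spec_proj_tendsto B) auto
  ultimately show ?thesis by (rule LIMSEQ_unique)
qed

text \<open>J commutes with every p(A) and is continuous. Later J is a complex scalar or the
  restriction to a subset.\<close>

lemma spec_proj_commute:
  assumes B: "B \<in> sets borel" and J: "bounded_linear J" "\<And>f. J (A f) = A (J f)"
  shows "J (spec_proj B f) = spec_proj B (J f)"
proof -
  obtain p where p: "\<And>h. h \<in> {f, J f} \<Longrightarrow> approximates B h p"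
    using approximates_exists[of "{f, J f}" B] B by auto
  have "(\<lambda>n. J (poly_op (p n) f)) \<longlonglongrightarrow> J (spec_proj B f)"
    using p by (intro bounded_linear.tendsto[OF J(1)] spec_proj_tendsto B) auto
  moreover have "(\<lambda>n. J (poly_op (p n) f)) \<longlonglongrightarrow> spec_proj B (J f)"
    unfolding poly_op_commute[of J, OF bounded_linear.linear[OF J(1)] J(2)]
    using p by (intro spec_proj_tendsto B) auto
  ultimately show ?thesis by (rule LIMSEQ_unique)
qed

text \<open>Both values are limits of integrals, of p_n for the first and of p_n^2 for the second.
  Their agreement is what makes \<open>spec_proj B\<close> idempotent.\<close>

lemma spec_proj_inner_self:
  assumes B [measurable]: "B \<in> sets borel"
  shows "spec_proj B f \<bullet> f = measure (spec_measure f) B" (is ?th1)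
    and "spec_proj B f \<bullet> spec_proj B f = measure (spec_measure f) B" (is ?th2)
proof -
  interpret unit_interval_measure "spec_measure f" by (rule spec_measure)
  obtain p where p: "approximates B f p"
    using approximates_exists[of "{f}" B] B by auto
  have ind: "\<bar>indicator B t :: real\<bar> \<le> 1" for t by (simp add: indicator_def)
  let ?I = "\<lambda>h. (\<integral>t. h t \<partial>spec_measure f)"
  have [simp]: "?I (indicator B) = measure (spec_measure f) B"
    using sets_eq_imp_space_eq[OF sets_borel] by simp
  have int_ind: "integrable (spec_measure f) (indicator B :: real \<Rightarrow> real)"
    by (rule integrable_bounded[OF _ ind]) simp
  have lim2: "(\<lambda>n. ?I (\<lambda>t. (poly (p n) t - indicator B t)\<^sup>2)) \<longlonglongrightarrow> 0"
    using p by (simp add: approximates_def)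
  have "(\<lambda>n. ?I (\<lambda>t. 1 * (poly (p n) t - indicator B t))) \<longlonglongrightarrow> 0"
    by (rule integral_mult_approximation_tendsto_0[OF _ _ _ ind lim2]) auto
  then have "(\<lambda>n. ?I (poly (p n)) - measure (spec_measure f) B) \<longlonglongrightarrow> 0"
    using int_ind integrable_poly by simp
  then have "(\<lambda>n. ?I (poly (p n))) \<longlonglongrightarrow> measure (spec_measure f) B" by (rule LIM_zero_cancel)
  then have "(\<lambda>n. poly_op (p n) f \<bullet> f) \<longlonglongrightarrow> measure (spec_measure f) B"
    by (simp add: integral_poly_spec_measure)
  moreover have "(\<lambda>n. poly_op (p n) f \<bullet> f) \<longlonglongrightarrow> spec_proj B f \<bullet> f"
    by (intro tendsto_intros spec_proj_tendsto B p)
  ultimately show ?th1 using LIMSEQ_unique by blast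
  have "(\<lambda>n. ?I (\<lambda>t. indicator B t * (poly (p n) t - indicator B t))) \<longlonglongrightarrow> 0"
    by (rule integral_mult_approximation_tendsto_0[OF _ _ ind ind lim2]) auto
  from tendsto_add[OF lim2 tendsto_mult[OF tendsto_const[of 2] this]]
  have lim: "(\<lambda>n. ?I (\<lambda>t. (poly (p n) t - indicator B t)\<^sup>2)
      + 2 * ?I (\<lambda>t. indicator B t * (poly (p n) t - indicator B t))) \<longlonglongrightarrow> 0"
    by simp
  \<comment> \<open>An indicator is its own square, so p^2 - 1_B = (p - 1_B)^2 + 2 1_B (p - 1_B),
    and the integrals of both terms on the right tend to 0.\<close>
  have eq: "?I (\<lambda>t. (poly (p n) t - indicator B t)\<^sup>2)
      + 2 * ?I (\<lambda>t. indicator B t * (poly (p n) t - indicator B t))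
      = poly_op (p n) f \<bullet> poly_op (p n) f - measure (spec_measure f) B" for n
  proof -
    have i1: "integrable (spec_measure f) (\<lambda>t. (poly (p n) t - indicator B t)\<^sup>2)"
      by (rule integrable_poly_diff_square[OF _ ind]) simp
    have i2: "integrable (spec_measure f) (\<lambda>t. poly (p n) t * indicator B t)"
      by (rule integrable_poly_mult[OF _ ind]) simp
    have i3: "integrable (spec_measure f) (\<lambda>t. indicator B t * (poly (p n) t - indicator B t))"
    proof -
      have "integrable (spec_measure f) (\<lambda>t. poly (p n) t * indicator B t - indicator B t)"
        using i2 int_ind by auto
      then show ?thesis
        by (rule Bochner_Integration.integrable_cong[THEN iffD1, rotated 2])
          (auto simp: indicator_def)
    qed
    have "?I (\<lambda>t. (poly (p n) t - indicator B t)\<^sup>2)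
        + 2 * ?I (\<lambda>t. indicator B t * (poly (p n) t - indicator B t))
        = ?I (\<lambda>t. (poly (p n) t - indicator B t)\<^sup>2
            + 2 * (indicator B t * (poly (p n) t - indicator B t)))"
      using i1 i3 by simp
    also have "\<dots> = ?I (\<lambda>t. poly (p n * p n) t - indicator B t)"
      by (intro Bochner_Integration.integral_cong refl)
        (auto simp: indicator_def power2_eq_square algebra_simps)
    also have "\<dots> = ?I (poly (p n * p n)) - measure (spec_measure f) B"
      using int_ind integrable_poly[of "p n * p n"] by (simp del: poly_mult)
    finally show ?thesis
      by (simp only: integral_poly_spec_measure poly_op_mult poly_op_sym)
  qed
  have "(\<lambda>n. poly_op (p n) f \<bullet> poly_op (p n) f) \<longlonglongrightarrow> measure (spec_measure f) B"
    using lim unfolding eq by (rule LIM_zero_cancel)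
  moreover have "(\<lambda>n. poly_op (p n) f \<bullet> poly_op (p n) f) \<longlonglongrightarrow> spec_proj B f \<bullet> spec_proj B f"
    by (intro tendsto_intros spec_proj_tendsto B p)
  ultimately show ?th2 using LIMSEQ_unique by blast
qed

text \<open>By symmetry the form of P^2 at f is <P f, P f>, which equals <P f, f>; so P^2 - P is
  symmetric with zero form.\<close>

lemma spec_proj_idem:
  assumes B: "B \<in> sets borel"
  shows "spec_proj B (spec_proj B f) = spec_proj B f"
proof -
  let ?P = "spec_proj B"
  note lin = linear_spec_proj[OF B]
  have "?P (?P f) - ?P f = 0"
  proof (rule symmetric_zero_form_imp_zero[of "\<lambda>f. ?P (?P f) - ?P f"])
    show "linear (\<lambda>f. ?P (?P f) - ?P f)"
      by (rule linearI) (simp_all add: linear_add[OF lin] linear_scale[OF lin] algebra_simps)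
    show "(?P (?P f) - ?P f) \<bullet> g = f \<bullet> (?P (?P g) - ?P g)" for f g
      by (simp add: inner_diff spec_proj_sym[OF B])
    show "(?P (?P f) - ?P f) \<bullet> f = 0" for f
      using spec_proj_inner_self[OF B, of f] spec_proj_sym[OF B, of "?P f" f]
      by (simp add: inner_diff_left)
  qed
  then show ?thesis by simp
qed

end

section \<open>Resolutions of the identity determined by their diagonal measures\<close>

locale resolution_of_identity =
  fixes P :: "real set \<Rightarrow> 'h::real_inner \<Rightarrow> 'h" and \<mu> :: "'h \<Rightarrow> real measure"
  assumes linear_proj: "\<And>B. B \<in> sets borel \<Longrightarrow> linear (P B)"
    and proj_sym: "\<And>B f g. B \<in> sets borel \<Longrightarrow> P B f \<bullet> g = f \<bullet> P B g"
    and proj_idem: "\<And>B f. B \<in> sets borel \<Longrightarrow> P B (P B f) = P B f"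
    and proj_inner_self: "\<And>B f. B \<in> sets borel \<Longrightarrow> P B f \<bullet> f = measure (\<mu> f) B"
    and finite_measure_\<mu>: "\<And>f. finite_measure (\<mu> f)"
    and sets_\<mu>: "\<And>f. sets (\<mu> f) = sets borel"
    and total_mass: "\<And>f. measure (\<mu> f) UNIV = f \<bullet> f"
begin

lemma proj_eq_self:
  assumes "B \<in> sets borel" "measure (\<mu> f) B = f \<bullet> f"
  shows "P B f = f"
proof -
  have "P B f \<bullet> P B f = P B f \<bullet> f"
    by (simp add: proj_sym[OF assms(1)] proj_idem[OF assms(1)])
  then have "(f - P B f) \<bullet> (f - P B f) = 0"
    using assms by (simp add: inner_diff inner_commute[of f "P B f"] proj_inner_self)
  then show ?thesis by simp
qed

lemma proj_union_disjoint:
  assumes [measurable]: "A \<in> sets borel" "B \<in> sets borel" and "A \<inter> B = {}"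
  shows "P (A \<union> B) f = P A f + P B f"
proof -
  have lin: "linear (P A)" "linear (P B)" "linear (P (A \<union> B))" by (simp_all add: linear_proj)
  have "P (A \<union> B) f - (P A f + P B f) = 0"
  proof (rule symmetric_zero_form_imp_zero[of "\<lambda>f. P (A \<union> B) f - (P A f + P B f)"])
    show "linear (\<lambda>f. P (A \<union> B) f - (P A f + P B f))"
      by (rule linearI) (simp_all add: lin linear_add linear_scale algebra_simps)
    show "(P (A \<union> B) f - (P A f + P B f)) \<bullet> g = f \<bullet> (P (A \<union> B) g - (P A g + P B g))" for f g
      by (simp add: inner_diff inner_add proj_sym)
    show "(P (A \<union> B) f - (P A f + P B f)) \<bullet> f = 0" for f
      using assms finite_measure.finite_measure_Union[OF finite_measure_\<mu>, of A f B]
      by (simp add: inner_diff inner_add proj_inner_self sets_\<mu>)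
  qed
  then show ?thesis by simp
qed

text \<open>For g = P B f, the form of P A + P B at g is at most <g, g>, and P B g = g already uses
  that up. Hence ||P A g||^2 = <P A g, g> <= 0.\<close>

lemma proj_disjoint:
  assumes [measurable]: "A \<in> sets borel" "B \<in> sets borel" and disj: "A \<inter> B = {}"
  shows "P A (P B f) = 0"
proof -
  let ?g = "P B f"
  have "P (A \<union> B) ?g \<bullet> ?g \<le> ?g \<bullet> ?g"
    using finite_measure.finite_measure_mono[OF finite_measure_\<mu>, of "A \<union> B" UNIV ?g]
    by (simp add: proj_inner_self sets_\<mu> total_mass)
  then have "P A ?g \<bullet> ?g \<le> 0"
    by (simp add: proj_union_disjoint[OF assms] inner_add_left proj_idem)
  then have "P A ?g \<bullet> P A ?g \<le> 0"
    using proj_sym[of A ?g "P A ?g"] by (simp add: proj_idem inner_commute)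
  then show ?thesis by (simp add: antisym_conv[OF inner_ge_zero])
qed

text \<open>Both sets are split at their intersection; by \<open>proj_disjoint\<close> only the
  product of the common part with itself survives.\<close>

lemma proj_Int:
  assumes [measurable]: "A \<in> sets borel" "B \<in> sets borel"
  shows "P (A \<inter> B) f = P A (P B f)"
proof -
  have lin: "linear (P A)" by (simp add: linear_proj)
  have split: "(A \<inter> B) \<union> (B - A) = B" "(A \<inter> B) \<union> (A - B) = A"
      "(A \<inter> B) \<inter> (B - A) = {}" "(A \<inter> B) \<inter> (A - B) = {}" by auto
  have "P B f = P (A \<inter> B) f + P (B - A) f"
    using proj_union_disjoint[of "A \<inter> B" "B - A" f] split by simp
  moreover have "P A (P (B - A) f) = 0" by (rule proj_disjoint) auto
  moreover have "P A (P (A \<inter> B) f) = P (A \<inter> B) (P (A \<inter> B) f) + P (A - B) (P (A \<inter> B) f)"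
    using proj_union_disjoint[of "A \<inter> B" "A - B" "P (A \<inter> B) f"] split by simp
  moreover have "P (A - B) (P (A \<inter> B) f) = 0" by (rule proj_disjoint) auto
  ultimately show ?thesis by (simp add: linear_add[OF lin] proj_idem)
qed

text \<open>Polarization of a real symmetric form reduces this to countable additivity of the
  diagonal measures.\<close>

lemma proj_sums:
  assumes A: "range A \<subseteq> sets borel" "disjoint_family A"
  shows "(\<lambda>i::nat. P (A i) f \<bullet> g) sums (P (\<Union>i. A i) f \<bullet> g)"
proof -
  have U: "(\<Union>i. A i) \<in> sets borel" using A by auto
  have polar: "P B f \<bullet> g = (P B (f + g) \<bullet> (f + g) - P B (f - g) \<bullet> (f - g)) / 4" if "B \<in> sets borel" for B
    using proj_sym[OF that, of g f] linear_proj[OF that]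
    by (simp add: linear_add linear_diff inner_add inner_diff inner_commute[of g "P B f"])
  have "(\<lambda>i. P (A i) h \<bullet> h) sums (P (\<Union>i. A i) h \<bullet> h)" for h
    using finite_measure.finite_measure_UNION[OF finite_measure_\<mu>, of A h] A U
    by (simp add: proj_inner_self sets_\<mu> range_subsetD)
  then have "(\<lambda>i. (P (A i) (f + g) \<bullet> (f + g) - P (A i) (f - g) \<bullet> (f - g)) / 4)
      sums ((P (\<Union>i. A i) (f + g) \<bullet> (f + g) - P (\<Union>i. A i) (f - g) \<bullet> (f - g)) / 4)"
    by (intro sums_divide sums_diff)
  moreover have "P (A i) f \<bullet> g = (P (A i) (f + g) \<bullet> (f + g) - P (A i) (f - g) \<bullet> (f - g)) / 4" for i
    using A(1) by (intro polar) auto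
  ultimately show ?thesis by (simp only: polar[OF U])
qed

end

text \<open>The calculus above applies to A = T / c. The projection of T for \<open>B\<close> is
  that of A for the preimage of \<open>B\<close> under multiplication by c, and the measures are
  pushed forward along the same map.\<close>

theorem spectral_theorem_bounded_positive:
  fixes T :: "'h::{real_inner,complete_space} \<Rightarrow> 'h"
  assumes T: "linear T" "\<And>f g. T f \<bullet> g = f \<bullet> T g" "\<And>f. 0 \<le> T f \<bullet> f" "\<And>f. T f \<bullet> f \<le> c * (f \<bullet> f)"
    and c: "0 < c"
  obtains P :: "real set \<Rightarrow> 'h \<Rightarrow> 'h" and \<mu> :: "'h \<Rightarrow> real measure"
  where "resolution_of_identity P \<mu>"
    and "\<And>B J f. B \<in> sets borel \<Longrightarrow> bounded_linear J \<Longrightarrow> (\<And>f. J (T f) = T (J f)) \<Longrightarrow> J (P B f) = P B (J f)"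
    and "\<And>f. AE t in \<mu> f. t \<in> {0..c}"
    and "\<And>f. (\<integral>t. t \<partial>\<mu> f) = T f \<bullet> f"
proof -
  define A where "A f = (1 / c) *\<^sub>R T f" for f
  interpret positive_contraction A
  proof (rule positive_contraction.intro)
    show "linear A"
      by (rule linearI) (simp_all add: A_def linear_add[OF T(1)] linear_scale[OF T(1)] algebra_simps)
  qed (use T c in \<open>auto simp: A_def field_simps\<close>)
  let ?s = "\<lambda>t::real. c * t"
  define P where "P B = spec_proj (?s -` B)" for B
  define \<mu> where "\<mu> f = distr (spec_measure f) borel ?s" for f
  have vim: "?s -` B \<in> sets borel" if "B \<in> sets borel" for B
    using measurable_sets[OF _ that, of ?s borel] by simp
  have meas: "?s \<in> measurable (spec_measure f) borel" for f
  proof -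
    interpret unit_interval_measure "spec_measure f" by (rule spec_measure)
    show ?thesis by simp
  qed
  have inner_self: "P B f \<bullet> f = measure (\<mu> f) B" if "B \<in> sets borel" for B f
  proof -
    interpret unit_interval_measure "spec_measure f" by (rule spec_measure)
    have "space (spec_measure f) = UNIV" using sets_eq_imp_space_eq[OF sets_borel] by simp
    then show ?thesis
      unfolding P_def \<mu>_def spec_proj_inner_self(1)[OF vim[OF that]]
      using that by (subst measure_distr[OF meas]) auto
  qed
  show ?thesis
  proof (rule that[of P \<mu>])
    show "resolution_of_identity P \<mu>"
    proof (rule resolution_of_identity.intro)
      fix B :: "real set" assume B: "B \<in> sets borel"
      show "linear (P B)" unfolding P_def by (rule linear_spec_proj[OF vim[OF B]])
      show "P B f \<bullet> g = f \<bullet> P B g" for f g unfolding P_def by (rule spec_proj_sym[OF vim[OF B]])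
      show "P B (P B f) = P B f" for f unfolding P_def by (rule spec_proj_idem[OF vim[OF B]])
      show "P B f \<bullet> f = measure (\<mu> f) B" for f by (rule inner_self[OF B])
    next
      fix f
      interpret unit_interval_measure "spec_measure f" by (rule spec_measure)
      show "finite_measure (\<mu> f)" unfolding \<mu>_def by (rule finite_measure_distr[OF meas])
      show "sets (\<mu> f) = sets borel" by (simp add: \<mu>_def)
      have "measure (\<mu> f) UNIV = measure (spec_measure f) (space (spec_measure f))"
        unfolding \<mu>_def by (subst measure_distr[OF meas]) auto
      also have "\<dots> = f \<bullet> f"
        using integral_poly_spec_measure[of f 1] by simp
      finally show "measure (\<mu> f) UNIV = f \<bullet> f" .
    qed
    show "J (P B f) = P B (J f)"
      if "B \<in> sets borel" and J: "bounded_linear J" "\<And>f. J (T f) = T (J f)" for B J f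
      unfolding P_def
      by (rule spec_proj_commute[OF vim[OF that(1)] J(1)])
        (simp add: A_def J(2) linear_scale[OF bounded_linear.linear[OF J(1)]])
  next
    fix f
    interpret unit_interval_measure "spec_measure f" by (rule spec_measure)
    show "AE t in \<mu> f. t \<in> {0..c}"
      unfolding \<mu>_def using AE_unit c
      by (subst AE_distr_iff[OF meas]) (auto elim!: eventually_mono simp: mult_le_cancel_left2)
    have "(\<integral>t. t \<partial>\<mu> f) = (\<integral>t. c * t \<partial>spec_measure f)"
      unfolding \<mu>_def by (rule integral_distr[OF meas]) simp
    also have "\<dots> = c * (\<integral>t. poly [:0, 1:] t \<partial>spec_measure f)" by simp
    also have "\<dots> = T f \<bullet> f"
      unfolding integral_poly_spec_measure using c by (simp add: A_def linear_0[OF T(1)])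
    finally show "(\<integral>t. t \<partial>\<mu> f) = T f \<bullet> f" .
  qed
qed

section \<open>Square-summable functions as a Hilbert space\<close>

lemma ell2_UNIV_iff: "f \<in> ell2 UNIV \<longleftrightarrow> (\<lambda>x. (cmod (f x))\<^sup>2) summable_on UNIV"
  by (simp add: ell2_def)

lemma ell2_iff: "f \<in> ell2 X \<longleftrightarrow> f \<in> ell2 UNIV \<and> (\<forall>x. x \<notin> X \<longrightarrow> f x = 0)"
proof -
  have "(\<lambda>x. (cmod (f x))\<^sup>2) summable_on X \<longleftrightarrow> (\<lambda>x. (cmod (f x))\<^sup>2) summable_on UNIV"
    if "\<forall>x. x \<notin> X \<longrightarrow> f x = 0"
    using that by (intro summable_on_cong_neutral) auto
  then show ?thesis by (auto simp: ell2_def)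
qed

lemma ell2_inner_UNIV:
  assumes "f \<in> ell2 X"
  shows "ell2_inner X f g = ell2_inner UNIV f g"
  unfolding ell2_inner_def using assms by (intro infsum_cong_neutral) (auto simp: ell2_def)

lemma ell2_comparison:
  assumes "f \<in> ell2 UNIV" "\<And>x. cmod (g x) \<le> c * cmod (f x)"
  shows "g \<in> ell2 UNIV"
  unfolding ell2_UNIV_iff
proof (rule summable_on_comparison_test)
  show "(\<lambda>x. c\<^sup>2 * (cmod (f x))\<^sup>2) summable_on UNIV"
    using assms(1) by (intro summable_on_cmult_right) (simp add: ell2_UNIV_iff)
  show "(cmod (g x))\<^sup>2 \<le> c\<^sup>2 * (cmod (f x))\<^sup>2" for x
    using power_mono[OF assms(2)[of x], of 2] by (simp add: power_mult_distrib)
qed simp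

lemma ell2_add:
  assumes "f \<in> ell2 UNIV" "g \<in> ell2 UNIV"
  shows "(\<lambda>x. f x + g x) \<in> ell2 UNIV"
  unfolding ell2_UNIV_iff
proof (rule summable_on_comparison_test)
  show "(\<lambda>x. 2 * (cmod (f x))\<^sup>2 + 2 * (cmod (g x))\<^sup>2) summable_on UNIV"
    using assms by (intro summable_on_add summable_on_cmult_right) (simp_all add: ell2_UNIV_iff)
  show "(cmod (f x + g x))\<^sup>2 \<le> 2 * (cmod (f x))\<^sup>2 + 2 * (cmod (g x))\<^sup>2" for x
  proof -
    have "(cmod (f x + g x))\<^sup>2 \<le> (cmod (f x) + cmod (g x))\<^sup>2"
      by (intro power_mono norm_triangle_ineq) simp
    moreover have "0 \<le> (cmod (f x) - cmod (g x))\<^sup>2" by simp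
    ultimately show ?thesis by (simp add: power2_eq_square algebra_simps)
  qed
qed simp

lemma ell2_cmult: "f \<in> ell2 UNIV \<Longrightarrow> (\<lambda>x. c * f x) \<in> ell2 UNIV"
  by (rule ell2_comparison[where c="cmod c"]) (auto simp: norm_mult)

lemma ell2_mult_cnj_summable:
  assumes "f \<in> ell2 UNIV" "g \<in> ell2 UNIV"
  shows "(\<lambda>x. f x * cnj (g x)) summable_on UNIV"
proof (rule abs_summable_summable, rule abs_summable_product)
  have "(\<lambda>x. norm (f x * f x)) = (\<lambda>x. (cmod (f x))\<^sup>2)"
      "(\<lambda>x. norm (cnj (g x) * cnj (g x))) = (\<lambda>x. (cmod (g x))\<^sup>2)"
    by (simp_all add: norm_mult power2_eq_square)
  then show "(\<lambda>x. norm (f x * f x)) summable_on UNIV" "(\<lambda>x. norm (cnj (g x) * cnj (g x))) summable_on UNIV"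
    using assms by (simp_all only: ell2_UNIV_iff)
qed

section \<open>The Hilbert space of square-summable functions on a whole type\<close>

typedef 'a l2 = "ell2 (UNIV :: 'a set)" morphisms l2_fun Abs_l2
  by (rule exI[of _ "\<lambda>_. 0"]) (simp add: ell2_def)

lemma l2_fun_Abs [simp]: "f \<in> ell2 UNIV \<Longrightarrow> l2_fun (Abs_l2 f) = f"
  by (rule Abs_l2_inverse)

lemma l2_fun_ell2 [simp]: "l2_fun f \<in> ell2 UNIV"
  by (rule l2_fun)

lemma l2_eqI: "(\<And>x. l2_fun f x = l2_fun g x) \<Longrightarrow> f = g"
  by (metis ext l2_fun_inject)

text \<open>The class structure on \<open>l2\<close> is that of a real space. Complex scalars enter
  as bounded real-linear operators, and complex linearity of an additive map is commutation with
  them.\<close>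

definition l2_scaleC :: "complex \<Rightarrow> 'a l2 \<Rightarrow> 'a l2" where
  "l2_scaleC c f = Abs_l2 (\<lambda>x. c * l2_fun f x)"

lemma l2_fun_scaleC [simp]: "l2_fun (l2_scaleC c f) x = c * l2_fun f x"
  by (simp add: l2_scaleC_def ell2_cmult)

instantiation l2 :: (type) real_vector
begin

definition "0 = Abs_l2 (\<lambda>_. 0)"
definition "f + g = Abs_l2 (\<lambda>x. l2_fun f x + l2_fun g x)"
definition "- f = l2_scaleC (-1) f"
definition "f - g = f + - (g :: 'a l2)"
definition "r *\<^sub>R f = l2_scaleC (complex_of_real r) f"

lemma l2_fun_zero [simp]: "l2_fun 0 x = 0"
  unfolding zero_l2_def by (subst l2_fun_Abs) (simp_all add: ell2_def)

lemma l2_fun_plus [simp]: "l2_fun (f + g) x = l2_fun f x + l2_fun g x"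
  unfolding plus_l2_def by (subst l2_fun_Abs) (simp_all add: ell2_add)

lemma l2_fun_uminus [simp]: "l2_fun (- f) x = - l2_fun f x"
  by (simp add: uminus_l2_def)

lemma l2_fun_minus [simp]: "l2_fun (f - g) x = l2_fun f x - l2_fun g x"
  by (simp add: minus_l2_def)

lemma l2_fun_scaleR [simp]: "l2_fun (r *\<^sub>R f) x = complex_of_real r * l2_fun f x"
  by (simp add: scaleR_l2_def)

instance
  by standard (auto intro!: l2_eqI simp: algebra_simps)

end

instantiation l2 :: (type) real_inner
begin

definition "inner f g = Re (ell2_inner UNIV (l2_fun f) (l2_fun g))"
definition "norm (f :: 'a l2) = sqrt (inner f f)"
definition "sgn (f :: 'a l2) = f /\<^sub>R norm f"
definition "dist f g = norm (f - g :: 'a l2)"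
definition "(uniformity :: ('a l2 \<times> 'a l2) filter) = (INF e\<in>{0 <..}. principal {(f, g). dist f g < e})"
definition "open U = (\<forall>f\<in>U. \<forall>\<^sub>F (f', g) in uniformity. f' = f \<longrightarrow> g \<in> U)" for U :: "'a l2 set"

lemma inner_l2_infsum: "inner f g = (\<Sum>\<^sub>\<infinity>x. Re (l2_fun f x * cnj (l2_fun g x)))"
  unfolding inner_l2_def ell2_inner_def
  by (rule infsum_Re[symmetric]) (rule ell2_mult_cnj_summable; simp)

lemma inner_l2_summable: "(\<lambda>x. Re (l2_fun f x * cnj (l2_fun g x))) summable_on UNIV"
  by (rule summable_on_Re) (rule ell2_mult_cnj_summable; simp)

lemma inner_l2_self: "inner f f = (\<Sum>\<^sub>\<infinity>x. (cmod (l2_fun f x))\<^sup>2)"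
  unfolding inner_l2_infsum by (simp add: cmod_power2 flip: power2_eq_square)

instance
proof
  fix f g h :: "'a l2" and r :: real
  show "inner f g = inner g f"
    unfolding inner_l2_infsum by (simp add: algebra_simps)
  show "inner (f + g) h = inner f h + inner g h"
    unfolding inner_l2_infsum
    by (subst infsum_add[OF inner_l2_summable inner_l2_summable, symmetric])
      (auto intro!: infsum_cong simp: algebra_simps)
  show "inner (r *\<^sub>R f) g = r * inner f g"
    unfolding inner_l2_infsum
    by (subst infsum_cmult_right'[symmetric]) (auto intro!: infsum_cong simp: algebra_simps)
  show "0 \<le> inner f f" unfolding inner_l2_self by (rule infsum_nonneg) simp
  show "inner f f = 0 \<longleftrightarrow> f = 0"
  proof
    assume "inner f f = 0"
    then have "(cmod (l2_fun f x))\<^sup>2 = 0" for x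
      using l2_fun_ell2[of f] unfolding inner_l2_self ell2_UNIV_iff
      by (intro nonneg_infsum_le_0D[of "\<lambda>x. (cmod (l2_fun f x))\<^sup>2" UNIV]) auto
    then show "f = 0" by (intro l2_eqI) simp
  qed (simp add: inner_l2_self)
qed (simp_all add: norm_l2_def sgn_l2_def dist_l2_def uniformity_l2_def open_l2_def)

end

lemma l2_fun_sum: "l2_fun (\<Sum>i\<in>I. g i) x = (\<Sum>i\<in>I. l2_fun (g i) x)"
  by (induction I rule: infinite_finite_induct) auto

lemma norm_l2_square: "(norm f)\<^sup>2 = (\<Sum>\<^sub>\<infinity>x. (cmod (l2_fun f x))\<^sup>2)"
  by (simp add: power2_norm_eq_inner inner_l2_self)

lemma sum_cmod_square_le_norm:
  assumes "finite F"
  shows "(\<Sum>x\<in>F. (cmod (l2_fun f x))\<^sup>2) \<le> (norm f)\<^sup>2"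
  unfolding norm_l2_square using l2_fun_ell2[of f] assms
  by (intro finite_sum_le_infsum) (auto simp: ell2_UNIV_iff)

lemma cmod_l2_fun_le_norm: "cmod (l2_fun f x) \<le> norm f"
  using sum_cmod_square_le_norm[of "{x}" f] by (simp add: power2_le_iff_abs_le)

instance l2 :: (type) complete_space
proof
  fix X :: "nat \<Rightarrow> 'a l2"
  assume X: "Cauchy X"
  have "Cauchy (\<lambda>n. l2_fun (X n) x)" for x
  proof (rule CauchyI)
    fix e :: real assume "0 < e"
    then obtain N where N: "\<And>m n. N \<le> m \<Longrightarrow> N \<le> n \<Longrightarrow> norm (X m - X n) < e"
      using CauchyD[OF X] by blast
    have "norm (l2_fun (X m) x - l2_fun (X n) x) < e" if "N \<le> m" "N \<le> n" for m n
      using cmod_l2_fun_le_norm[of "X m - X n" x] N[OF that] by simp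
    then show "\<exists>M. \<forall>m\<ge>M. \<forall>n\<ge>M. norm (l2_fun (X m) x - l2_fun (X n) x) < e" by blast
  qed
  then have "\<exists>l. (\<lambda>n. l2_fun (X n) x) \<longlonglongrightarrow> l" for x
    by (simp add: Cauchy_convergent_iff convergent_def)
  then obtain g where g: "\<And>x. (\<lambda>n. l2_fun (X n) x) \<longlonglongrightarrow> g x" by metis
  \<comment> \<open>The Cauchy bound is taken on a finite set F, where m can tend to infinity
    pointwise. The result is uniform in F, which yields both square-summability and convergence in
    norm.\<close>
  have tail: "\<exists>N. \<forall>n\<ge>N. \<forall>F. finite F \<longrightarrow> (\<Sum>x\<in>F. (cmod (l2_fun (X n) x - g x))\<^sup>2) \<le> e\<^sup>2"
    if "0 < e" for e :: real
  proof -
    obtain N where N: "\<And>m n. N \<le> m \<Longrightarrow> N \<le> n \<Longrightarrow> norm (X m - X n) < e"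
      using CauchyD[OF X \<open>0 < e\<close>] by blast
    have "(\<Sum>x\<in>F. (cmod (l2_fun (X n) x - g x))\<^sup>2) \<le> e\<^sup>2" if "N \<le> n" "finite F" for n F
    proof (rule tendsto_upperbound)
      show "(\<lambda>m. \<Sum>x\<in>F. (cmod (l2_fun (X n) x - l2_fun (X m) x))\<^sup>2)
          \<longlonglongrightarrow> (\<Sum>x\<in>F. (cmod (l2_fun (X n) x - g x))\<^sup>2)"
        by (intro tendsto_intros g)
      show "\<forall>\<^sub>F m in sequentially. (\<Sum>x\<in>F. (cmod (l2_fun (X n) x - l2_fun (X m) x))\<^sup>2) \<le> e\<^sup>2"
        using eventually_ge_at_top[of N]
      proof eventually_elim
        fix m assume "N \<le> m"
        then have "(norm (X n - X m))\<^sup>2 \<le> e\<^sup>2" using N[of n m] that by (intro power_mono) auto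
        then show "(\<Sum>x\<in>F. (cmod (l2_fun (X n) x - l2_fun (X m) x))\<^sup>2) \<le> e\<^sup>2"
          using sum_cmod_square_le_norm[OF that(2), of "X n - X m"] by simp
      qed
    qed simp
    then show ?thesis by blast
  qed
  have diff: "(\<lambda>x. l2_fun (X n) x - g x) \<in> ell2 UNIV"
    if "\<And>F. finite F \<Longrightarrow> (\<Sum>x\<in>F. (cmod (l2_fun (X n) x - g x))\<^sup>2) \<le> e\<^sup>2" for n and e :: real
    unfolding ell2_UNIV_iff
  proof (rule nonneg_bdd_above_summable_on)
    show "bdd_above (sum (\<lambda>x. (cmod (l2_fun (X n) x - g x))\<^sup>2) ` {F. F \<subseteq> UNIV \<and> finite F})"
      using that by (intro bdd_aboveI[of _ "e\<^sup>2"]) auto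
  qed simp
  obtain N where "\<And>F. finite F \<Longrightarrow> (\<Sum>x\<in>F. (cmod (l2_fun (X N) x - g x))\<^sup>2) \<le> 1\<^sup>2"
    using tail[of 1] by auto
  \<comment> \<open>The limit is recovered as X N - (X N - g), a difference of square-summable
    functions.\<close>
  then have "(\<lambda>x. l2_fun (X N) x + (-1) * (l2_fun (X N) x - g x)) \<in> ell2 UNIV"
    by (intro ell2_add ell2_cmult diff l2_fun_ell2)
  then have g_ell2: "g \<in> ell2 UNIV" by simp
  have "X \<longlonglongrightarrow> Abs_l2 g"
  proof (rule LIMSEQ_I)
    fix r :: real assume "0 < r"
    then obtain N where N: "\<And>n F. N \<le> n \<Longrightarrow> finite F \<Longrightarrow>
        (\<Sum>x\<in>F. (cmod (l2_fun (X n) x - g x))\<^sup>2) \<le> (r / 2)\<^sup>2"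
      using tail[of "r / 2"] by auto
    have "norm (X n - Abs_l2 g) < r" if "N \<le> n" for n
    proof -
      have "(norm (X n - Abs_l2 g))\<^sup>2 \<le> (r / 2)\<^sup>2"
        unfolding norm_l2_square
      proof (rule infsum_le_finite_sums)
        show "(\<lambda>x. (cmod (l2_fun (X n - Abs_l2 g) x))\<^sup>2) summable_on UNIV"
          using l2_fun_ell2[of "X n - Abs_l2 g"] by (simp only: ell2_UNIV_iff)
      qed (use N[OF that] g_ell2 in simp)
      then have "norm (X n - Abs_l2 g) \<le> r / 2"
        using \<open>0 < r\<close> by (simp add: power2_le_iff_abs_le)
      then show ?thesis using \<open>0 < r\<close> by linarith
    qed
    then show "\<exists>no. \<forall>n\<ge>no. norm (X n - Abs_l2 g) < r" by blast
  qed
  then show "convergent X" by (auto simp: convergent_def)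
qed

text \<open>The second slot is conjugate-linear, so pairing with i g multiplies the inner product by
  -i, and Re (-i z) = Im z.\<close>

lemma ell2_inner_l2_fun:
  "ell2_inner UNIV (l2_fun f) (l2_fun g) = Complex (f \<bullet> g) (f \<bullet> l2_scaleC \<i> g)"
proof (rule complex_eqI)
  have "l2_fun f x * cnj (l2_fun (l2_scaleC \<i> g) x) = - \<i> * (l2_fun f x * cnj (l2_fun g x))" for x
    by simp
  then have "ell2_inner UNIV (l2_fun f) (l2_fun (l2_scaleC \<i> g)) = - \<i> * ell2_inner UNIV (l2_fun f) (l2_fun g)"
    unfolding ell2_inner_def by (simp only: infsum_cmult_right')
  then show "Im (ell2_inner UNIV (l2_fun f) (l2_fun g)) = Im (Complex (f \<bullet> g) (f \<bullet> l2_scaleC \<i> g))"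
    by (simp add: inner_l2_def)
qed (simp add: inner_l2_def)

lemma norm_l2_scaleC [simp]: "norm (l2_scaleC c f) = cmod c * norm f"
proof -
  have "(norm (l2_scaleC c f))\<^sup>2 = (cmod c * norm f)\<^sup>2"
    by (simp add: norm_l2_square norm_mult power_mult_distrib infsum_cmult_right')
  then show ?thesis by (simp add: power2_eq_iff_nonneg)
qed

lemma bounded_linear_l2_scaleC: "bounded_linear (l2_scaleC c)"
  by (rule bounded_linear_intro[where K="cmod c"]) (auto intro!: l2_eqI simp: algebra_simps)

lemma ell2_norm_l2_fun: "ell2_norm UNIV (l2_fun f) = norm f"
  by (simp add: ell2_norm_def norm_l2_def inner_l2_self)

text \<open>One construction serves the restriction to X, the right translations in the Laplacian
  and the left translations that commute with it.\<close>

definition l2_pullback :: "'a set \<Rightarrow> ('a \<Rightarrow> 'a) \<Rightarrow> 'a l2 \<Rightarrow> 'a l2" where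
  "l2_pullback X \<phi> f = Abs_l2 (\<lambda>x. if x \<in> X then l2_fun f (\<phi> x) else 0)"

lemma l2_fun_pullback:
  assumes "bij_betw \<phi> X X"
  shows "l2_fun (l2_pullback X \<phi> f) x = (if x \<in> X then l2_fun f (\<phi> x) else 0)"
proof -
  have "(\<lambda>x. (cmod (l2_fun f x))\<^sup>2) summable_on X"
    using l2_fun_ell2[of f] by (auto simp: ell2_UNIV_iff intro: summable_on_subset_banach)
  then have "(\<lambda>x. (cmod (l2_fun f (\<phi> x)))\<^sup>2) summable_on X"
    by (subst summable_on_reindex_bij_betw[OF assms, of "\<lambda>x. (cmod (l2_fun f x))\<^sup>2"])
  also have "?this \<longleftrightarrow> (\<lambda>x. (cmod (if x \<in> X then l2_fun f (\<phi> x) else 0))\<^sup>2) summable_on UNIV"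
    by (intro summable_on_cong_neutral) auto
  finally show ?thesis by (simp add: l2_pullback_def ell2_UNIV_iff)
qed

lemma l2_pullback_adjoint:
  assumes \<phi>: "bij_betw \<phi> X X" and \<psi>: "bij_betw \<psi> X X" and inverse: "\<And>x. x \<in> X \<Longrightarrow> \<psi> (\<phi> x) = x"
  shows "l2_pullback X \<phi> f \<bullet> g = f \<bullet> l2_pullback X \<psi> g"
proof -
  have "l2_pullback X \<phi> f \<bullet> g = (\<Sum>\<^sub>\<infinity>x\<in>X. Re (l2_fun f (\<phi> x) * cnj (l2_fun g x)))"
    unfolding inner_l2_infsum using \<phi>
    by (intro infsum_cong_neutral) (auto simp: l2_fun_pullback)
  also have "\<dots> = (\<Sum>\<^sub>\<infinity>x\<in>X. Re (l2_fun f (\<phi> x) * cnj (l2_fun g (\<psi> (\<phi> x)))))"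
    by (intro infsum_cong) (simp add: inverse)
  also have "\<dots> = (\<Sum>\<^sub>\<infinity>y\<in>X. Re (l2_fun f y * cnj (l2_fun g (\<psi> y))))"
    by (rule infsum_reindex_bij_betw[OF \<phi>])
  also have "\<dots> = f \<bullet> l2_pullback X \<psi> g"
    unfolding inner_l2_infsum using \<psi>
    by (intro infsum_cong_neutral) (auto simp: l2_fun_pullback)
  finally show ?thesis .
qed

lemma norm_l2_pullback_le:
  assumes "bij_betw \<phi> X X"
  shows "norm (l2_pullback X \<phi> f) \<le> norm f"
proof (rule power2_le_imp_le)
  have sum: "(\<lambda>x. (cmod (l2_fun f x))\<^sup>2) summable_on UNIV"
    using l2_fun_ell2[of f] by (simp add: ell2_UNIV_iff)
  have "(norm (l2_pullback X \<phi> f))\<^sup>2 = (\<Sum>\<^sub>\<infinity>x\<in>X. (cmod (l2_fun f (\<phi> x)))\<^sup>2)"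
    unfolding norm_l2_square using assms
    by (intro infsum_cong_neutral) (auto simp: l2_fun_pullback)
  also have "\<dots> = (\<Sum>\<^sub>\<infinity>x\<in>X. (cmod (l2_fun f x))\<^sup>2)"
    by (rule infsum_reindex_bij_betw[OF assms])
  also have "\<dots> \<le> (norm f)\<^sup>2"
    unfolding norm_l2_square
    by (rule infsum_mono_neutral) (use sum in \<open>auto intro: summable_on_subset_banach\<close>)
  finally show "(norm (l2_pullback X \<phi> f))\<^sup>2 \<le> (norm f)\<^sup>2" .
qed simp

lemma bounded_linear_l2_pullback:
  assumes "bij_betw \<phi> X X"
  shows "bounded_linear (l2_pullback X \<phi>)"
  by (rule bounded_linear_intro[where K=1])
    (auto intro!: l2_eqI simp: l2_fun_pullback[OF assms] norm_l2_pullback_le[OF assms])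

section \<open>The spectral measure of the Laplace operator\<close>

lemma l2_scaleC_adjoint: "l2_scaleC c f \<bullet> g = f \<bullet> l2_scaleC (cnj c) g"
  unfolding inner_l2_infsum by (intro infsum_cong) (simp add: algebra_simps)

lemma inner_l2_scaleC_i: "f \<bullet> l2_scaleC \<i> g = - (l2_scaleC \<i> f \<bullet> g)"
proof -
  have "l2_scaleC (cnj \<i>) g = - l2_scaleC \<i> g" by (rule l2_eqI) simp
  then show ?thesis by (simp add: l2_scaleC_adjoint)
qed

abbreviation l2_restrict :: "'a set \<Rightarrow> 'a l2 \<Rightarrow> 'a l2" where
  "l2_restrict X \<equiv> l2_pullback X (\<lambda>x. x)"

lemma bij_betw_ident: "bij_betw (\<lambda>x. x) X X"
  by (simp add: bij_betw_def)

text \<open>Functions supported in X appear as fixed vectors of restriction, so an operator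
  commuting with restriction maps them to themselves.\<close>

lemma l2_restrict_eq_iff: "l2_restrict X f = f \<longleftrightarrow> l2_fun f \<in> ell2 X"
proof
  assume *: "l2_restrict X f = f"
  have "l2_fun (l2_restrict X f) x = 0" if "x \<notin> X" for x
    using that by (simp add: l2_fun_pullback[OF bij_betw_ident])
  then show "l2_fun f \<in> ell2 X" using * by (subst ell2_iff) simp
next
  assume "l2_fun f \<in> ell2 X"
  then show "l2_restrict X f = f"
    by (intro l2_eqI) (auto simp: l2_fun_pullback[OF bij_betw_ident] ell2_def)
qed

lemma l2_restrict_Abs:
  assumes "f \<in> ell2 X"
  shows "l2_fun (Abs_l2 f) = f" "l2_restrict X (Abs_l2 f) = Abs_l2 f"
proof -
  have "f \<in> ell2 UNIV" using assms by (simp add: ell2_iff[of f X])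
  then show "l2_fun (Abs_l2 f) = f" by simp
  then show "l2_restrict X (Abs_l2 f) = Abs_l2 f" using assms by (simp add: l2_restrict_eq_iff)
qed

lemma ell2_inner_Abs:
  assumes "f \<in> ell2 X" "g \<in> ell2 X"
  shows "ell2_inner X f g = Complex (Abs_l2 f \<bullet> Abs_l2 g) (Abs_l2 f \<bullet> l2_scaleC \<i> (Abs_l2 g))"
  using ell2_inner_l2_fun[of "Abs_l2 f" "Abs_l2 g"] assms
  by (simp add: ell2_inner_UNIV l2_restrict_Abs(1))

lemma Abs_l2_linear_combination:
  assumes "f \<in> ell2 X" "g \<in> ell2 X"
  shows "Abs_l2 (\<lambda>x. a * f x + b * g x) = l2_scaleC a (Abs_l2 f) + l2_scaleC b (Abs_l2 g)"
proof (rule l2_eqI)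
  have "f \<in> ell2 UNIV" "g \<in> ell2 UNIV" using assms by (auto simp: ell2_iff[of _ X])
  then show "l2_fun (Abs_l2 (\<lambda>x. a * f x + b * g x)) x
      = l2_fun (l2_scaleC a (Abs_l2 f) + l2_scaleC b (Abs_l2 g)) x" for x
    by (simp add: ell2_add ell2_cmult)
qed

text \<open>The real spectral theorem is applied on all of \<open>l2\<close> and the result cut down
  to \<open>ell2 X\<close>. Commutation with scalars makes the projections complex linear and
  self-adjoint for the complex inner product; commutation with restriction keeps them inside
  \<open>ell2 X\<close>.\<close>

theorem is_spectral_measure_exists:
  fixes T :: "('a \<Rightarrow> complex) \<Rightarrow> 'a \<Rightarrow> complex" and T' :: "'a l2 \<Rightarrow> 'a l2"
  assumes T': "linear T'" "\<And>f g. T' f \<bullet> g = f \<bullet> T' g" "\<And>f. 0 \<le> T' f \<bullet> f" "\<And>f. T' f \<bullet> f \<le> c * (f \<bullet> f)"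
    and c: "0 < c"
    and scaleC: "\<And>a f. l2_scaleC a (T' f) = T' (l2_scaleC a f)"
    and restrict: "\<And>f. l2_restrict X (T' f) = T' (l2_restrict X f)"
    and T: "\<And>f. f \<in> ell2 X \<Longrightarrow> T f = l2_fun (T' (Abs_l2 f))"
  shows "\<exists>P. is_spectral_measure X T P"
proof -
  obtain Q :: "real set \<Rightarrow> 'a l2 \<Rightarrow> 'a l2" and \<mu> where Q: "resolution_of_identity Q \<mu>"
    and commute: "\<And>B J f. B \<in> sets borel \<Longrightarrow> bounded_linear J \<Longrightarrow> (\<And>f. J (T' f) = T' (J f)) \<Longrightarrow> J (Q B f) = Q B (J f)"
    and support: "\<And>f. AE t in \<mu> f. t \<in> {0..c}"
    and integral: "\<And>f. (\<integral>t. t \<partial>\<mu> f) = T' f \<bullet> f"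
    using spectral_theorem_bounded_positive[OF T' c] by blast
  interpret Q: resolution_of_identity Q \<mu> by (rule Q)
  define P where "P B f = l2_fun (Q B (Abs_l2 f))" for B f
  have Q_scaleC: "Q B (l2_scaleC a f) = l2_scaleC a (Q B f)" if "B \<in> sets borel" for B a f
    using commute[OF that bounded_linear_l2_scaleC scaleC] by simp
  have P_in: "P B f \<in> ell2 X" if "B \<in> sets borel" "f \<in> ell2 X" for B f
  proof -
    have "l2_restrict X (Q B (Abs_l2 f)) = Q B (l2_restrict X (Abs_l2 f))"
      by (rule commute[OF that(1) bounded_linear_l2_pullback[OF bij_betw_ident] restrict])
    then show ?thesis using that(2) by (simp add: P_def l2_restrict_Abs flip: l2_restrict_eq_iff)
  qed
  have Abs_P: "Abs_l2 (P B f) = Q B (Abs_l2 f)" for B f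
    by (simp add: P_def l2_fun_inverse)
  have inner_P: "ell2_inner X (P B f) g
      = Complex (Q B (Abs_l2 f) \<bullet> Abs_l2 g) (Q B (Abs_l2 f) \<bullet> l2_scaleC \<i> (Abs_l2 g))"
    if "B \<in> sets borel" "f \<in> ell2 X" "g \<in> ell2 X" for B f g
    using ell2_inner_Abs[OF P_in[OF that(1,2)] that(3)] by (simp add: Abs_P)
  have UNIV: "Q UNIV f = f" for f
    by (rule Q.proj_eq_self) (simp_all add: Q.total_mass)
  have proj: "orthogonal_projection X (P B)" if B: "B \<in> sets borel" for B
    unfolding orthogonal_projection_def
  proof (intro conjI ballI allI)
    show "P B \<in> ell2 X \<rightarrow> ell2 X" using P_in[OF B] by blast
    fix f assume f: "f \<in> ell2 X"
    show "P B (P B f) = P B f"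
      using Q.proj_idem[OF B] by (simp add: P_def l2_fun_inverse)
    fix g assume g: "g \<in> ell2 X"
    show "P B (\<lambda>x. a * f x + b * g x) = (\<lambda>x. a * P B f x + b * P B g x)" for a b
      unfolding P_def Abs_l2_linear_combination[OF f g]
      by (simp add: linear_add[OF Q.linear_proj[OF B]] Q_scaleC[OF B] fun_eq_iff)
    show "ell2_inner X (P B f) g = ell2_inner X f (P B g)"
      unfolding inner_P[OF B f g] ell2_inner_Abs[OF f P_in[OF B g]] Abs_P
      by (simp add: Q.proj_sym[OF B] Q_scaleC[OF B])
  qed
  have pvm: "projection_valued_measure X P"
    unfolding projection_valued_measure_def
  proof (intro conjI ballI allI impI)
    show "orthogonal_projection X (P B)" if "B \<in> sets borel" for B by (rule proj[OF that])
    show "P UNIV f = f" if "f \<in> ell2 X" for f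
      using that by (simp add: P_def UNIV l2_restrict_Abs)
    show "P (A \<inter> B) f = P A (P B f)" if "A \<in> sets borel" "B \<in> sets borel" for A B f
      using Q.proj_Int[OF that] by (simp add: P_def l2_fun_inverse)
    fix A :: "nat \<Rightarrow> real set" and f g
    assume A: "range A \<subseteq> sets borel" "disjoint_family A" and fg: "f \<in> ell2 X" "g \<in> ell2 X"
    have A_i: "A i \<in> sets borel" for i using A by auto
    have U: "(\<Union>i. A i) \<in> sets borel" using A by auto
    show "(\<lambda>i. ell2_inner X (P (A i) f) g) sums ell2_inner X (P (\<Union>i. A i) f) g"
      unfolding inner_P[OF A_i fg] inner_P[OF U fg] sums_complex_iff
      using Q.proj_sums[OF A] by simp
  qed
  have scalar: "scalar_spectral_measure X P f = \<mu> (Abs_l2 f)" if f: "f \<in> ell2 X" for f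
  proof -
    have space: "space (\<mu> (Abs_l2 f)) = UNIV"
      using sets_eq_imp_space_eq[OF Q.sets_\<mu>] by simp
    have "scalar_spectral_measure X P f = measure_of UNIV (sets borel) (emeasure (\<mu> (Abs_l2 f)))"
      unfolding scalar_spectral_measure_def
    proof (rule measure_of_eq)
      fix B :: "real set" assume "B \<in> sigma_sets UNIV (sets borel)"
      then have B: "B \<in> sets borel" using sets.sigma_sets_eq[of "borel :: real measure"] by simp
      show "ennreal (Re (ell2_inner X (P B f) f)) = emeasure (\<mu> (Abs_l2 f)) B"
        unfolding inner_P[OF B f f]
        by (simp add: Q.proj_inner_self[OF B] finite_measure.emeasure_eq_measure[OF Q.finite_measure_\<mu>])
    qed simp
    also have "\<dots> = \<mu> (Abs_l2 f)"
      using measure_of_of_measure[of "\<mu> (Abs_l2 f)"] by (simp add: space Q.sets_\<mu>)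
    finally show ?thesis .
  qed
  have "P {0..c} f = f" if "f \<in> ell2 X" for f
  proof -
    have "measure (\<mu> g) {0..c} = g \<bullet> g" for g
    proof -
      have "measure (\<mu> g) {0..c} = measure (\<mu> g) UNIV"
        using support[of g] Q.sets_\<mu>[of g] by (intro measure_eq_AE) auto
      then show ?thesis by (simp add: Q.total_mass)
    qed
    then have "Q {0..c} (Abs_l2 f) = Abs_l2 f" by (intro Q.proj_eq_self) auto
    then show ?thesis using that by (simp add: P_def l2_restrict_Abs)
  qed
  then have supp: "\<exists>K. compact K \<and> (\<forall>f\<in>ell2 X. P K f = f)" using compact_Icc by blast
  have "ell2_inner X (T f) f = complex_of_real (\<integral>t. t \<partial>scalar_spectral_measure X P f)"
    if f: "f \<in> ell2 X" for f
  proof -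
    let ?v = "Abs_l2 f"
    have "l2_restrict X (T' ?v) = T' ?v"
      using restrict[of ?v] f by (simp add: l2_restrict_Abs)
    then have Tf: "T f \<in> ell2 X" using T[OF f] by (simp add: l2_restrict_eq_iff)
    \<comment> \<open>Multiplication by i is skew and commutes with T', so this number equals its
      own negative: the quadratic form of T' is real.\<close>
    have "T' ?v \<bullet> l2_scaleC \<i> ?v = ?v \<bullet> l2_scaleC \<i> (T' ?v)"
      by (simp add: T'(2) scaleC)
    then have "T' ?v \<bullet> l2_scaleC \<i> ?v = 0"
      using inner_l2_scaleC_i[of ?v "T' ?v"] by (simp add: inner_commute)
    then show ?thesis
      unfolding scalar[OF f] integral ell2_inner_Abs[OF Tf f]
      by (simp add: T[OF f] l2_fun_inverse complex_eq_iff)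
  qed
  then show ?thesis
    unfolding is_spectral_measure_def using pvm supp by blast
qed

section \<open>The Laplace operator on \<open>l2\<close>\<close>

locale symmetric_generating_set = group G for G (structure) +
  fixes S :: "'a set"
  assumes finite_S: "finite S" and S_nonempty: "S \<noteq> {}" and S_carrier: "S \<subseteq> carrier G"
    and S_inv: "\<And>s. s \<in> S \<Longrightarrow> inv s \<in> S"
begin

abbreviation right_translation :: "'a \<Rightarrow> 'a l2 \<Rightarrow> 'a l2" where
  "right_translation s \<equiv> l2_pullback (carrier G) (\<lambda>x. x \<otimes> inv s)"

abbreviation left_translation :: "'a \<Rightarrow> 'a l2 \<Rightarrow> 'a l2" where
  "left_translation y \<equiv> l2_pullback (carrier G) (\<lambda>x. y \<otimes> x)"

abbreviation restr :: "'a l2 \<Rightarrow> 'a l2" where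
  "restr \<equiv> l2_restrict (carrier G)"

lemma bij_right: "s \<in> carrier G \<Longrightarrow> bij_betw (\<lambda>x. x \<otimes> inv s) (carrier G) (carrier G)"
  by (rule bij_betw_byWitness[where f'="\<lambda>x. x \<otimes> s"]) (auto simp: m_assoc)

lemma bij_left: "y \<in> carrier G \<Longrightarrow> bij_betw (\<lambda>x. y \<otimes> x) (carrier G) (carrier G)"
  by (rule bij_betw_byWitness[where f'="\<lambda>x. inv y \<otimes> x"]) (auto simp flip: m_assoc)

text \<open>\<open>restr\<close> stands in for the identity, so that the operator ignores values off
  the carrier and returns 0 there, in agreement with \<open>laplace\<close> on
  \<open>ell2 (carrier G)\<close>.\<close>

definition lap :: "'a l2 \<Rightarrow> 'a l2" where
  "lap f = restr f - (1 / real (card S)) *\<^sub>R (\<Sum>s\<in>S. right_translation s f)"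

lemma l2_fun_right_translation:
  "s \<in> S \<Longrightarrow> l2_fun (right_translation s f) x = (if x \<in> carrier G then l2_fun f (x \<otimes> inv s) else 0)"
  using S_carrier by (intro l2_fun_pullback bij_right) auto

lemma l2_fun_lap:
  "l2_fun (lap f) x = (if x \<in> carrier G
     then l2_fun f x - complex_of_real (1 / real (card S)) * (\<Sum>s\<in>S. l2_fun f (x \<otimes> inv s)) else 0)"
  by (auto simp: lap_def l2_fun_sum l2_fun_pullback[OF bij_betw_ident] l2_fun_right_translation)

lemma laplace_eq_lap:
  assumes f: "f \<in> ell2 (carrier G)"
  shows "laplace G S f = l2_fun (lap (Abs_l2 f))"
proof
  fix x
  show "laplace G S f x = l2_fun (lap (Abs_l2 f)) x"
  proof (cases "x \<in> carrier G")
    case True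
    have "(\<Sum>\<^sub>\<infinity>\<gamma>\<in>carrier G. f (x \<otimes> inv \<gamma>) * complex_of_real (uniform_weight S \<gamma>))
        = (\<Sum>\<^sub>\<infinity>\<gamma>\<in>S. f (x \<otimes> inv \<gamma>) * complex_of_real (1 / real (card S)))"
      using S_carrier by (intro infsum_cong_neutral) (auto simp: uniform_weight_def)
    also have "\<dots> = complex_of_real (1 / real (card S)) * (\<Sum>s\<in>S. f (x \<otimes> inv s))"
      using finite_S by (simp add: sum_distrib_left mult.commute)
    finally show ?thesis
      using True by (simp add: laplace_def right_convolution_def l2_fun_lap l2_restrict_Abs(1)[OF f])
  next
    case False
    then show ?thesis using f by (simp add: laplace_def right_convolution_def l2_fun_lap ell2_def)
  qed
qed

lemma lap_scaleC: "l2_scaleC a (lap f) = lap (l2_scaleC a f)"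
  by (rule l2_eqI) (simp add: l2_fun_lap right_diff_distrib sum_distrib_left mult.left_commute)

lemma lap_restr: "restr (lap f) = lap (restr f)"
proof (rule l2_eqI)
  fix x
  have "l2_fun (restr f) (x \<otimes> inv s) = l2_fun f (x \<otimes> inv s)" if "x \<in> carrier G" "s \<in> S" for s
    using that S_carrier by (auto simp: l2_fun_pullback[OF bij_betw_ident])
  then show "l2_fun (restr (lap f)) x = l2_fun (lap (restr f)) x"
    by (simp add: l2_fun_lap l2_fun_pullback[OF bij_betw_ident])
qed

text \<open>Left and right multiplication commute by associativity. This is what allows a point mass
  to be moved to the identity.\<close>

lemma lap_left_translation:
  assumes y: "y \<in> carrier G"
  shows "left_translation y (lap f) = lap (left_translation y f)"
proof (rule l2_eqI)
  fix x
  have "l2_fun (left_translation y f) (x \<otimes> inv s) = l2_fun f (y \<otimes> x \<otimes> inv s)" if "x \<in> carrier G" "s \<in> S" for s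
    using that S_carrier y by (auto simp: l2_fun_pullback[OF bij_left[OF y]] m_assoc)
  then show "l2_fun (left_translation y (lap f)) x = l2_fun (lap (left_translation y f)) x"
    using y by (simp add: l2_fun_lap l2_fun_pullback[OF bij_left[OF y]])
qed

lemma linear_lap: "linear lap"
  by (rule linearI) (auto intro!: l2_eqI simp: l2_fun_lap sum.distrib sum_distrib_left algebra_simps)

text \<open>The adjoint of translation by s is translation by its inverse, and inversion permutes
  S.\<close>

lemma lap_sym: "lap f \<bullet> g = f \<bullet> lap g"
proof -
  have "right_translation s f \<bullet> g = f \<bullet> right_translation (inv s) g" if "s \<in> S" for s
    using that S_carrier S_inv
    by (intro l2_pullback_adjoint bij_right) (auto simp: m_assoc)
  then have "(\<Sum>s\<in>S. right_translation s f \<bullet> g) = (\<Sum>s\<in>S. f \<bullet> right_translation (inv s) g)"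
    by simp
  also have "\<dots> = (\<Sum>s\<in>S. f \<bullet> right_translation s g)"
    using S_carrier S_inv by (intro sum.reindex_bij_witness[of _ "\<lambda>s. inv s" "\<lambda>s. inv s"]) auto
  finally have "(\<Sum>s\<in>S. right_translation s f \<bullet> g) = (\<Sum>s\<in>S. f \<bullet> right_translation s g)" .
  moreover have "restr f \<bullet> g = f \<bullet> restr g"
    by (intro l2_pullback_adjoint bij_betw_ident) simp
  ultimately show ?thesis
    by (simp add: lap_def inner_diff inner_sum_left inner_sum_right)
qed

text \<open>Each translation is a contraction, so for g = restr f the averaged term lies between
  -<g, g> and <g, g>; the 2 is 1 - (-1).\<close>

lemma lap_bounds: "0 \<le> lap f \<bullet> f" "lap f \<bullet> f \<le> 2 * (f \<bullet> f)"
proof -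
  let ?g = "restr f"
  have idem: "restr (restr f) = restr f" by (rule l2_eqI) (simp add: l2_fun_pullback[OF bij_betw_ident])
  have "lap f = restr (lap f)" by (rule l2_eqI) (simp add: l2_fun_lap l2_fun_pullback[OF bij_betw_ident])
  then have "lap f \<bullet> f = restr (lap f) \<bullet> f" by simp
  also have "\<dots> = lap f \<bullet> ?g" by (intro l2_pullback_adjoint bij_betw_ident) simp
  also have "\<dots> = restr (lap f) \<bullet> ?g" using \<open>lap f = restr (lap f)\<close> by simp
  finally have eq: "lap f \<bullet> f = lap ?g \<bullet> ?g" by (simp add: lap_restr)
  define a where "a = (\<Sum>s\<in>S. right_translation s ?g \<bullet> ?g)"
  have lap_g: "lap ?g \<bullet> ?g = ?g \<bullet> ?g - (1 / real (card S)) * a"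
    by (simp add: lap_def idem inner_diff inner_sum_left a_def)
  have "\<bar>right_translation s ?g \<bullet> ?g\<bar> \<le> ?g \<bullet> ?g" if "s \<in> S" for s
  proof -
    have "\<bar>right_translation s ?g \<bullet> ?g\<bar> \<le> norm (right_translation s ?g) * norm ?g"
      by (rule Cauchy_Schwarz_ineq2)
    also have "\<dots> \<le> norm ?g * norm ?g"
      using that S_carrier by (intro mult_right_mono norm_l2_pullback_le bij_right) auto
    finally show ?thesis by (simp add: power2_norm_eq_inner flip: power2_eq_square)
  qed
  then have "\<bar>a\<bar> \<le> (\<Sum>s\<in>S. ?g \<bullet> ?g)"
    unfolding a_def by (intro order_trans[OF sum_abs] sum_mono)
  then have "\<bar>(1 / real (card S)) * a\<bar> \<le> ?g \<bullet> ?g"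
    using finite_S S_nonempty by (simp add: abs_mult divide_le_eq card_gt_0_iff mult.commute)
  moreover have "?g \<bullet> ?g \<le> f \<bullet> f"
    using power_mono[OF norm_l2_pullback_le[OF bij_betw_ident, of "carrier G" f], of 2]
    by (simp add: power2_norm_eq_inner)
  ultimately show "0 \<le> lap f \<bullet> f" "lap f \<bullet> f \<le> 2 * (f \<bullet> f)"
    unfolding eq lap_g by linarith+
qed

lemma spectral_measure_laplace_exists: "\<exists>P. is_spectral_measure (carrier G) (laplace G S) P"
  by (rule is_spectral_measure_exists[OF linear_lap lap_sym lap_bounds _ lap_scaleC lap_restr laplace_eq_lap])
    simp_all

end

section \<open>Properties of an arbitrary spectral measure\<close>

text \<open>A spectral measure prescribes only the diagonal of T. If the form splits along the range
  and kernel of E, the cross terms <T E u, w - E w> vanish, so T preserves both subspaces.\<close>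

lemma commute_of_form_decomposition:
  fixes T E :: "'h::real_inner \<Rightarrow> 'h"
  assumes T: "linear T" "\<And>f g. T f \<bullet> g = f \<bullet> T g"
    and E: "linear E" "\<And>f g. E f \<bullet> g = f \<bullet> E g" "\<And>f. E (E f) = E f"
    and decomp: "\<And>f. T f \<bullet> f = T (E f) \<bullet> E f + T (f - E f) \<bullet> (f - E f)"
  shows "T (E f) = E (T f)"
proof -
  have off: "T (E u) \<bullet> (w - E w) = 0" for u w
  proof -
    let ?v = "E u + (w - E w)"
    have "E ?v = E u" by (simp add: linear_add[OF E(1)] linear_diff[OF E(1)] E(3))
    then have "T ?v \<bullet> ?v = T (E u) \<bullet> E u + T (w - E w) \<bullet> (w - E w)"
      using decomp[of ?v] by simp
    moreover have "T ?v \<bullet> ?v = T (E u) \<bullet> E u + T (w - E w) \<bullet> (w - E w) + 2 * (T (E u) \<bullet> (w - E w))"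
      using T(2)[of "w - E w" "E u"] inner_commute[of "w - E w" "T (E u)"]
      by (simp add: linear_add[OF T(1)] inner_add)
    ultimately show ?thesis by simp
  qed
  have "(T (E u) - E (T (E u))) \<bullet> w = 0" for u w
    using off[of u w] by (simp add: inner_diff E(2))
  then have inv: "T (E u) = E (T (E u))" for u
    by (metis eq_iff_diff_eq_0 inner_eq_zero_iff)
  have "E (T (w - E w)) \<bullet> u = 0" for u w
    using off[of u w] by (simp add: E(2) T(2) inner_commute[of _ "w - E w"])
  then have "E (T (f - E f)) = 0" by (metis inner_eq_zero_iff)
  then have "E (T f) = E (T (E f))"
    by (simp add: linear_diff[OF T(1)] linear_diff[OF E(1)])
  then show ?thesis using inv[of f] by simp
qed

lemma funpow_commute:
  assumes "\<And>f. T (E f) = E (T f)"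
  shows "(T ^^ n) (E f) = E ((T ^^ n) f)"
  by (induction n) (simp_all add: assms)

lemma positive_form_Cauchy_Schwarz:
  fixes T :: "'h::real_inner \<Rightarrow> 'h"
  assumes T: "linear T" "\<And>f g. T f \<bullet> g = f \<bullet> T g" "\<And>f. 0 \<le> T f \<bullet> f"
  shows "(T f \<bullet> g)\<^sup>2 \<le> (T f \<bullet> f) * (T g \<bullet> g)"
proof -
  let ?a = "T f \<bullet> f" and ?b = "T f \<bullet> g" and ?c = "T g \<bullet> g"
  have q: "0 \<le> ?a * x\<^sup>2 + 2 * ?b * x + ?c" for x :: real
  proof -
    have "T (x *\<^sub>R f + g) \<bullet> (x *\<^sub>R f + g) = ?a * x\<^sup>2 + 2 * ?b * x + ?c"
      using T(2)[of g f]
      by (simp add: linear_add[OF T(1)] linear_scale[OF T(1)] inner_add power2_eq_square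
          inner_commute[of g "T f"] algebra_simps)
    then show ?thesis using T(3)[of "x *\<^sub>R f + g"] by simp
  qed
  show ?thesis
  proof (cases "?a = 0")
    case True
    have "?b = 0"
    proof (rule ccontr)
      assume "?b \<noteq> 0"
      \<comment> \<open>With ?a = 0 the form is affine in x, and this x gives the value -1.\<close>
      then show False using q[of "- (?c + 1) / (2 * ?b)"] True by simp
    qed
    then show ?thesis using True by simp
  next
    case False
    then have "0 < ?a" using T(3)[of f] by simp
    have "?a * (- ?b / ?a)\<^sup>2 + 2 * ?b * (- ?b / ?a) + ?c = ?c - ?b\<^sup>2 / ?a"
      using False by (simp add: field_simps power2_eq_square)
    then have "?b\<^sup>2 / ?a \<le> ?c" using q[of "- ?b / ?a"] by linarith
    then show ?thesis using \<open>0 < ?a\<close> by (simp add: field_simps)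
  qed
qed

text \<open>Cauchy-Schwarz for the form of T turns the form bound into a norm bound: for u in the
  range of E, ||T u||^4 <= <T u, u> <T T u, T u> <= a^2 ||u||^2 ||T u||^2, as T u lies in the range
  again.\<close>

lemma norm_funpow_le:
  fixes T E :: "'h::real_inner \<Rightarrow> 'h"
  assumes T: "linear T" "\<And>f g. T f \<bullet> g = f \<bullet> T g" "\<And>f. 0 \<le> T f \<bullet> f"
    and commute: "\<And>f. T (E f) = E (T f)" and idem: "\<And>f. E (E f) = E f"
    and upper: "\<And>f. T (E f) \<bullet> E f \<le> a * (norm (E f))\<^sup>2" and a: "0 \<le> a"
  shows "norm ((T ^^ n) (E f)) \<le> a ^ n * norm (E f)"
proof (induction n)
  case (Suc n)
  have step: "norm (T (E g)) \<le> a * norm (E g)" for g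
  proof (cases "T (E g) = 0")
    case False
    let ?u = "E g"
    have "T ?u = E (T ?u)" by (simp add: commute idem)
    then have "T (T ?u) \<bullet> T ?u \<le> a * (norm (T ?u))\<^sup>2" using upper[of "T ?u"] by simp
    then have "(T ?u \<bullet> ?u) * (T (T ?u) \<bullet> T ?u) \<le> (a * (norm ?u)\<^sup>2) * (a * (norm (T ?u))\<^sup>2)"
      using T(3) upper[of g] a by (intro mult_mono) auto
    then have "(T ?u \<bullet> T ?u)\<^sup>2 \<le> (a * norm ?u)\<^sup>2 * (norm (T ?u))\<^sup>2"
      using positive_form_Cauchy_Schwarz[OF T, of ?u "T ?u"] by (simp add: power2_eq_square algebra_simps)
    then have "(norm (T ?u))\<^sup>2 * (norm (T ?u))\<^sup>2 \<le> (a * norm ?u)\<^sup>2 * (norm (T ?u))\<^sup>2"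
      by (simp only: power2_norm_eq_inner power2_eq_square[of "T ?u \<bullet> T ?u"])
    then have "(norm (T ?u))\<^sup>2 \<le> (a * norm ?u)\<^sup>2"
      using False by (simp only: mult_le_cancel_right) simp
    then show ?thesis using a by (auto dest: power2_le_imp_le)
  qed (use a in simp)
  have "norm ((T ^^ Suc n) (E f)) = norm (T (E ((T ^^ n) f)))"
    by (simp add: funpow_commute[of T E, OF commute])
  also have "\<dots> \<le> a * norm (E ((T ^^ n) f))" by (rule step)
  also have "\<dots> = a * norm ((T ^^ n) (E f))"
    by (simp add: funpow_commute[of T E, OF commute])
  also have "\<dots> \<le> a * (a ^ n * norm (E f))" using Suc a by (intro mult_left_mono)
  finally show ?case by simp
qed simp

lemma norm_projection_le:
  fixes E :: "'h::real_inner \<Rightarrow> 'h"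
  assumes "\<And>f g. E f \<bullet> g = f \<bullet> E g" "\<And>f. E (E f) = E f"
  shows "norm (E f) \<le> norm f"
proof -
  have "(norm (E f))\<^sup>2 = E f \<bullet> f" by (simp add: power2_norm_eq_inner assms)
  also have "\<dots> \<le> norm (E f) * norm f" by (rule norm_cauchy_schwarz)
  finally show ?thesis by (cases "E f = 0") (simp_all add: power2_eq_square)
qed

text \<open>Growth of the iterates \<open>T ^ n h\<close> detects the spectral subspaces without reference to the
  spectral measure; this replaces the uniqueness of the spectral measure in the comparison of
  translates.\<close>

lemma spectral_part_eq_0_of_growth:
  fixes T E :: "'h::real_inner \<Rightarrow> 'h"
  assumes E: "\<And>f g. E f \<bullet> g = f \<bullet> E g" "\<And>f. E (E f) = E f"
    and commute: "\<And>f. T (E f) = E (T f)"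
    and lower: "\<And>f. b * (norm (E f))\<^sup>2 \<le> T (E f) \<bullet> E f"
    and ab: "0 \<le> a" "a < b"
    and growth: "\<And>n. norm ((T ^^ n) h) \<le> C * a ^ n"
  shows "E h = 0"
proof (rule ccontr)
  assume "E h \<noteq> 0"
  have step: "b * norm (E f) \<le> norm (T (E f))" for f
  proof (cases "E f = 0")
    case False
    have "b * (norm (E f))\<^sup>2 \<le> norm (T (E f)) * norm (E f)"
      using lower[of f] norm_cauchy_schwarz[of "T (E f)" "E f"] by linarith
    then show ?thesis using False by (simp add: power2_eq_square)
  qed simp
  have ge: "b ^ n * norm (E h) \<le> norm (E ((T ^^ n) h))" for n
  proof (induction n)
    case (Suc n)
    have "b ^ Suc n * norm (E h) = b * (b ^ n * norm (E h))" by simp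
    also have "\<dots> \<le> b * norm (E ((T ^^ n) h))" using Suc ab by (intro mult_left_mono) auto
    also have "\<dots> \<le> norm (T (E ((T ^^ n) h)))" by (rule step)
    finally show ?case by (simp add: commute)
  qed simp
  have le: "norm (E h) \<le> C * (a / b) ^ n" for n
  proof -
    have "b ^ n * norm (E h) \<le> C * a ^ n"
      using ge[of n] norm_projection_le[OF E, of "(T ^^ n) h"] growth[of n] by linarith
    then show ?thesis using ab by (simp add: power_divide field_simps)
  qed
  have "(\<lambda>n. C * (a / b) ^ n) \<longlonglongrightarrow> C * 0"
    using ab by (intro tendsto_intros LIMSEQ_power_zero) auto
  then have "norm (E h) \<le> 0"
    using le by (intro tendsto_lowerbound[where F=sequentially]) auto
  then show False using \<open>E h \<noteq> 0\<close> by simp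
qed

section \<open>Lifting a given spectral measure to \<open>l2\<close>\<close>

locale l2_spectral_measure =
  fixes X :: "'a set" and T P and T' :: "'a l2 \<Rightarrow> 'a l2"
  assumes spectral: "is_spectral_measure X T P"
    and T_eq: "\<And>f. f \<in> ell2 X \<Longrightarrow> T f = l2_fun (T' (Abs_l2 f))"
    and linear_T': "linear T'"
    and T'_sym: "\<And>f g. T' f \<bullet> g = f \<bullet> T' g"
    and T'_nonneg: "\<And>f. 0 \<le> T' f \<bullet> f"
    and T'_restrict: "\<And>f. T' (l2_restrict X f) = T' f" "\<And>f. l2_restrict X (T' f) = T' f"
begin

lemma pvm: "projection_valued_measure X P"
  using spectral by (simp add: is_spectral_measure_def)

lemma P_projection: "B \<in> sets borel \<Longrightarrow> orthogonal_projection X (P B)"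
  using pvm by (simp add: projection_valued_measure_def)

lemma P_in: "B \<in> sets borel \<Longrightarrow> f \<in> ell2 X \<Longrightarrow> P B f \<in> ell2 X"
  using P_projection[of B] unfolding orthogonal_projection_def by blast

lemma P_UNIV: "f \<in> ell2 X \<Longrightarrow> P UNIV f = f"
  using pvm by (simp add: projection_valued_measure_def)

lemma P_Int: "A \<in> sets borel \<Longrightarrow> B \<in> sets borel \<Longrightarrow> f \<in> ell2 X \<Longrightarrow> P (A \<inter> B) f = P A (P B f)"
  using pvm by (simp add: projection_valued_measure_def)

lemma P_adjoint:
  "B \<in> sets borel \<Longrightarrow> f \<in> ell2 X \<Longrightarrow> g \<in> ell2 X \<Longrightarrow> ell2_inner X (P B f) g = ell2_inner X f (P B g)"
  using P_projection by (simp add: orthogonal_projection_def)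

lemma P_sums:
  "range A \<subseteq> sets borel \<Longrightarrow> disjoint_family A \<Longrightarrow> f \<in> ell2 X \<Longrightarrow> g \<in> ell2 X \<Longrightarrow>
    (\<lambda>i::nat. ell2_inner X (P (A i) f) g) sums ell2_inner X (P (\<Union>i. A i) f) g"
  using pvm by (simp add: projection_valued_measure_def)

lemma restrict_in: "l2_fun (l2_restrict X v) \<in> ell2 X"
  by (subst ell2_iff) (simp add: l2_fun_pullback[OF bij_betw_ident])

text \<open>\<open>P\<close> is controlled only on \<open>ell2 X\<close>, so vectors are restricted
  before it is applied; \<open>Q UNIV\<close> is the restriction to X instead of the
  identity.\<close>

definition Q :: "real set \<Rightarrow> 'a l2 \<Rightarrow> 'a l2" where
  "Q B v = Abs_l2 (P B (l2_fun (l2_restrict X v)))"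

lemma l2_fun_Q: "B \<in> sets borel \<Longrightarrow> l2_fun (Q B v) = P B (l2_fun (l2_restrict X v))"
  unfolding Q_def by (rule l2_restrict_Abs(1)[OF P_in[OF _ restrict_in]])

lemma restrict_Q: "B \<in> sets borel \<Longrightarrow> l2_restrict X (Q B v) = Q B v"
  by (subst l2_restrict_eq_iff) (simp add: l2_fun_Q P_in restrict_in)

lemma restrict_sym: "l2_restrict X v \<bullet> w = v \<bullet> l2_restrict X w"
  by (intro l2_pullback_adjoint bij_betw_ident) simp

lemma Q_inner: "B \<in> sets borel \<Longrightarrow> Q B v \<bullet> w = Re (ell2_inner X (P B (l2_fun (l2_restrict X v))) (l2_fun (l2_restrict X w)))"
proof -
  assume B: "B \<in> sets borel"
  have "Q B v \<bullet> w = Q B v \<bullet> l2_restrict X w"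
    using restrict_sym[of "Q B v" w] by (simp add: restrict_Q[OF B])
  then show ?thesis
    using P_in[OF B restrict_in, of v] by (simp add: inner_l2_def ell2_inner_UNIV[of _ X] l2_fun_Q[OF B])
qed

lemma Q_sym:
  assumes B: "B \<in> sets borel"
  shows "Q B v \<bullet> w = v \<bullet> Q B w"
proof -
  have "v \<bullet> Q B w = l2_restrict X v \<bullet> Q B w"
    using restrict_sym[of v "Q B w"] by (simp add: restrict_Q[OF B])
  also have "\<dots> = Re (ell2_inner X (l2_fun (l2_restrict X v)) (P B (l2_fun (l2_restrict X w))))"
    by (simp add: inner_l2_def ell2_inner_UNIV[of _ X] restrict_in l2_fun_Q[OF B])
  finally show ?thesis by (simp add: Q_inner[OF B] P_adjoint[OF B restrict_in restrict_in])
qed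

lemma Q_Int:
  assumes "A \<in> sets borel" "B \<in> sets borel"
  shows "Q (A \<inter> B) v = Q A (Q B v)"
proof -
  have "Q A (Q B v) = Abs_l2 (P A (l2_fun (Q B v)))"
    by (simp add: Q_def[of A] restrict_Q[OF assms(2)])
  then show ?thesis by (simp add: l2_fun_Q assms Q_def[of "A \<inter> B"] P_Int restrict_in)
qed

lemma Q_idem: "B \<in> sets borel \<Longrightarrow> Q B (Q B v) = Q B v"
  using Q_Int[of B B v] by simp

lemma Q_UNIV: "Q UNIV v = l2_restrict X v"
  by (simp add: Q_def P_UNIV restrict_in l2_fun_inverse)

lemma P_linear_combination:
  assumes "B \<in> sets borel" "f \<in> ell2 X" "g \<in> ell2 X"
  shows "P B (\<lambda>x. a * f x + b * g x) = (\<lambda>x. a * P B f x + b * P B g x)"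
  using P_projection[OF assms(1)] assms(2,3) unfolding orthogonal_projection_def by blast

lemma Q_add:
  assumes B: "B \<in> sets borel"
  shows "Q B (v + w) = Q B v + Q B w"
proof (rule l2_eqI)
  have "l2_fun (l2_restrict X (v + w)) = (\<lambda>x. 1 * l2_fun (l2_restrict X v) x + 1 * l2_fun (l2_restrict X w) x)"
    by (auto simp: l2_fun_pullback[OF bij_betw_ident])
  then show "l2_fun (Q B (v + w)) x = l2_fun (Q B v + Q B w) x" for x
    using P_linear_combination[OF B restrict_in restrict_in, of 1 v 1 w] by (simp add: l2_fun_Q[OF B])
qed

lemma Q_scaleC:
  assumes B: "B \<in> sets borel"
  shows "Q B (l2_scaleC c v) = l2_scaleC c (Q B v)"
proof (rule l2_eqI)
  have "l2_fun (l2_restrict X (l2_scaleC c v))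
      = (\<lambda>x. c * l2_fun (l2_restrict X v) x + 0 * l2_fun (l2_restrict X v) x)"
    by (auto simp: l2_fun_pullback[OF bij_betw_ident])
  then show "l2_fun (Q B (l2_scaleC c v)) x = l2_fun (l2_scaleC c (Q B v)) x" for x
    using P_linear_combination[OF B restrict_in restrict_in, of c v 0 v] by (simp add: l2_fun_Q[OF B])
qed

lemma linear_Q: "B \<in> sets borel \<Longrightarrow> linear (Q B)"
  by (rule linearI) (simp_all add: Q_add scaleR_l2_def Q_scaleC)

lemma Q_sums:
  assumes "range A \<subseteq> sets borel" "disjoint_family A"
  shows "(\<lambda>i::nat. Q (A i) v \<bullet> w) sums (Q (\<Union>i. A i) v \<bullet> w)"
proof -
  have "A i \<in> sets borel" for i using assms by auto
  moreover have "(\<Union>i. A i) \<in> sets borel" using assms by auto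
  ultimately show ?thesis
    using P_sums[OF assms restrict_in restrict_in, of v w] by (simp add: Q_inner sums_complex_iff)
qed

text \<open>A series with equal terms converges only if the term is 0; the sequence of empty sets is
  disjoint.\<close>

lemma Q_empty: "Q {} v = 0"
proof -
  have "(\<lambda>i::nat. Q {} v \<bullet> Q {} v) sums (Q {} v \<bullet> Q {} v)"
    using Q_sums[of "\<lambda>_. {}" v "Q {} v"] by (simp add: disjoint_family_on_def)
  then have "(\<lambda>i::nat. Q {} v \<bullet> Q {} v) \<longlonglongrightarrow> 0"
    by (intro summable_LIMSEQ_zero sums_summable)
  then show ?thesis by (simp add: LIMSEQ_const_iff)
qed

lemma Q_compl:
  assumes B: "B \<in> sets borel"
  shows "Q B v + Q (- B) v = l2_restrict X v"
proof -
  have "(Q B v + Q (- B) v) \<bullet> w = l2_restrict X v \<bullet> w" for w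
  proof -
    have "(\<lambda>i. Q (binaryset B (- B) i) v \<bullet> w) sums (Q (\<Union>i. binaryset B (- B) i) v \<bullet> w)"
      by (rule Q_sums) (use B in \<open>auto simp: binaryset_def disjoint_family_on_def\<close>)
    moreover have "(\<Union>i. binaryset B (- B) i) = UNIV" by (simp add: UN_binaryset_eq)
    moreover have "(\<lambda>i. Q (binaryset B (- B) i) v \<bullet> w) sums (Q B v \<bullet> w + Q (- B) v \<bullet> w)"
      by (rule binaryset_sums) (simp add: Q_empty)
    ultimately show ?thesis by (simp add: inner_add_left Q_UNIV sums_unique2)
  qed
  then show ?thesis using vector_eq_rdot by blast
qed

definition M :: "'a l2 \<Rightarrow> real measure" where
  "M v = scalar_spectral_measure X P (l2_fun (l2_restrict X v))"

lemma sets_M [simp, measurable_cong]: "sets (M v) = sets borel"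
  unfolding M_def scalar_spectral_measure_def
  using sets.sigma_sets_eq[of "borel :: real measure"] by (simp add: sets_measure_of)

lemma space_M [simp]: "space (M v) = UNIV"
  using sets_eq_imp_space_eq[OF sets_M] by simp

lemma Q_inner_self: "B \<in> sets borel \<Longrightarrow> Q B v \<bullet> v = (norm (Q B v))\<^sup>2"
  by (simp add: power2_norm_eq_inner Q_sym Q_idem)

text \<open>\<open>measure_of\<close> keeps the given set function only if it is positive and
  countably additive, and is 0 otherwise, so both properties have to be checked.\<close>

lemma emeasure_M:
  assumes B: "B \<in> sets borel"
  shows "emeasure (M v) B = ennreal (Q B v \<bullet> v)"
proof -
  let ?m = "\<lambda>B. ennreal (Re (ell2_inner X (P B (l2_fun (l2_restrict X v))) (l2_fun (l2_restrict X v))))"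
  have m: "?m B = ennreal (Q B v \<bullet> v)" if "B \<in> sets borel" for B
    using Q_inner[OF that, of v v] by simp
  have "emeasure (M v) B = ?m B"
  proof (rule emeasure_measure_of)
    show "M v = measure_of UNIV (sets borel) ?m" by (simp add: M_def scalar_spectral_measure_def)
    show "positive (sets (M v)) ?m"
      using m[of "{}"] by (simp add: positive_def Q_empty)
    show "countably_additive (sets (M v)) ?m"
      unfolding countably_additive_def
    proof (intro allI impI)
      fix A :: "nat \<Rightarrow> real set"
      assume A: "range A \<subseteq> sets (M v)" "disjoint_family A" "(\<Union>i. A i) \<in> sets (M v)"
      then have A_i: "A i \<in> sets borel" for i by auto
      have "(\<Sum>i. ennreal (Q (A i) v \<bullet> v)) = ennreal (Q (\<Union>i. A i) v \<bullet> v)"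
        using A Q_sums[of A v v] by (intro suminf_ennreal_eq) (auto simp: Q_inner_self[OF A_i])
      then show "(\<Sum>i. ?m (A i)) = ?m (\<Union>i. A i)" using A by (simp add: m A_i)
    qed
  qed (use B in auto)
  then show ?thesis using m[OF B] by simp
qed

lemma finite_measure_M: "finite_measure (M v)"
  by (rule finite_measureI) (simp add: emeasure_M)

lemma measure_M: "B \<in> sets borel \<Longrightarrow> measure (M v) B = (norm (Q B v))\<^sup>2"
  by (simp add: measure_def emeasure_M Q_inner_self)

lemma integral_M: "(\<integral>t. t \<partial>M v) = T' v \<bullet> v"
proof -
  let ?f = "l2_fun (l2_restrict X v)"
  have Tf: "T ?f = l2_fun (T' v)"
    using T_eq[OF restrict_in, of v] by (simp add: l2_fun_inverse T'_restrict)
  have "ell2_inner X (T ?f) ?f = complex_of_real (\<integral>t. t \<partial>M v)"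
    using spectral restrict_in[of v] by (simp add: is_spectral_measure_def M_def)
  moreover have "Re (ell2_inner X (T ?f) ?f) = T' v \<bullet> l2_restrict X v"
    using T'_restrict(2)[of v] unfolding l2_restrict_eq_iff
    by (simp add: Tf ell2_inner_UNIV[of _ X] inner_l2_def)
  moreover have "T' v \<bullet> l2_restrict X v = T' v \<bullet> v"
    using restrict_sym[of "T' v" v] by (simp add: T'_restrict)
  ultimately show ?thesis by (metis Re_complex_of_real)
qed

text \<open>Compact support of the spectral measure makes t bounded almost everywhere. Integrability
  is what allows the integral to be split over \<open>B\<close> and its complement.\<close>

lemma integrable_M: "integrable (M v) (\<lambda>t. t)"
proof -
  interpret finite_measure "M v" by (rule finite_measure_M)
  obtain K where K: "compact K" "\<And>f. f \<in> ell2 X \<Longrightarrow> P K f = f"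
    using spectral by (auto simp: is_spectral_measure_def)
  then have borel: "K \<in> sets borel" by (auto intro: borel_compact)
  have "Q K v = l2_restrict X v" using K(2)[OF restrict_in, of v] by (simp add: Q_def l2_fun_inverse)
  then have "Q (- K) v = 0" using Q_compl[OF borel, of v] by simp
  then have "emeasure (M v) (- K) = 0" using borel by (simp add: emeasure_M)
  then have "AE t in M v. t \<in> K" using borel by (intro AE_I[of _ _ "- K"]) auto
  moreover obtain b where b: "\<And>t. t \<in> K \<Longrightarrow> norm t \<le> b"
    using compact_imp_bounded[OF K(1)] by (auto simp: bounded_iff)
  ultimately show ?thesis
    by (intro integrable_const_bound[where B=b]) (auto elim: eventually_mono)
qed

text \<open>Because projections multiply, the measure of Q B v is that of v cut to \<open>B\<close>.
  The form of T' on the range of Q B thus becomes an integral over \<open>B\<close>.\<close>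

lemma M_Q:
  assumes B [measurable]: "B \<in> sets borel"
  shows "M (Q B v) = density (M v) (\<lambda>t. ennreal (indicator B t))"
proof (rule measure_eqI)
  fix A assume "A \<in> sets (M (Q B v))"
  then have A [measurable]: "A \<in> sets borel" by simp
  have "emeasure (density (M v) (\<lambda>t. ennreal (indicator B t))) A
      = (\<integral>\<^sup>+t. ennreal (indicator B t) * indicator A t \<partial>M v)"
    by (rule emeasure_density) auto
  also have "\<dots> = (\<integral>\<^sup>+t. indicator (A \<inter> B) t \<partial>M v)"
    by (intro nn_integral_cong) (auto simp: indicator_def)
  also have "\<dots> = ennreal (Q (A \<inter> B) v \<bullet> v)"
    by (simp add: emeasure_M)
  also have "Q (A \<inter> B) v \<bullet> v = Q A (Q B v) \<bullet> Q B v"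
  proof -
    have "A \<inter> B = B \<inter> (A \<inter> B)" by auto
    then have "Q (A \<inter> B) v = Q B (Q A (Q B v))"
      using Q_Int[OF B sets.Int[OF A B], of v] Q_Int[OF A B, of v] by simp
    then show ?thesis by (simp add: Q_sym[OF B])
  qed
  finally show "emeasure (M (Q B v)) A = emeasure (density (M v) (\<lambda>t. ennreal (indicator B t))) A"
    by (simp add: emeasure_M)
qed simp

lemma T'_Q_inner:
  assumes B [measurable]: "B \<in> sets borel"
  shows "T' (Q B v) \<bullet> Q B v = (\<integral>t. indicator B t * t \<partial>M v)"
  using integral_M[of "Q B v"] unfolding M_Q[OF B] by (subst (asm) integral_density) auto

lemma integrable_indicator_M:
  assumes [measurable]: "B \<in> sets borel"
  shows "integrable (M v) (\<lambda>t. indicator B t * t)"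
  by (rule Bochner_Integration.integrable_bound[OF integrable_M[of v]]) (auto simp: indicator_def)

lemma T'_Q_commute:
  assumes B [measurable]: "B \<in> sets borel"
  shows "T' (Q B v) = Q B (T' v)"
proof (rule commute_of_form_decomposition[OF linear_T' T'_sym linear_Q[OF B] Q_sym[OF B] Q_idem[OF B]])
  fix f
  have "T' f \<bullet> f = (\<integral>t. indicator B t * t + indicator (- B) t * t \<partial>M f)"
    unfolding integral_M[symmetric] by (intro Bochner_Integration.integral_cong) (auto simp: indicator_def)
  also have "\<dots> = T' (Q B f) \<bullet> Q B f + T' (Q (- B) f) \<bullet> Q (- B) f"
    by (simp add: T'_Q_inner integrable_indicator_M)
  \<comment> \<open>T' does not see values off X, so the complementary part f - Q B f may be
    restricted to X, where it is Q (- B) f.\<close>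
  also have "Q (- B) f = l2_restrict X (f - Q B f)"
  proof -
    have "l2_restrict X (f - Q B f) = l2_restrict X f - Q B f"
      by (simp add: linear_diff[OF bounded_linear.linear[OF bounded_linear_l2_pullback[OF bij_betw_ident]]]
          restrict_Q[OF B])
    then show ?thesis by (simp flip: Q_compl[OF B, of f])
  qed
  also have "T' (l2_restrict X (f - Q B f)) \<bullet> l2_restrict X (f - Q B f) = T' (f - Q B f) \<bullet> (f - Q B f)"
    using restrict_sym[of "T' (f - Q B f)" "f - Q B f"] by (simp add: T'_restrict)
  finally show "T' f \<bullet> f = T' (Q B f) \<bullet> Q B f + T' (f - Q B f) \<bullet> (f - Q B f)" .
qed

lemma T'_Q_upper: "T' (Q {..a} v) \<bullet> Q {..a} v \<le> a * (norm (Q {..a} v))\<^sup>2"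
proof -
  interpret finite_measure "M v" by (rule finite_measure_M)
  have "T' (Q {..a} v) \<bullet> Q {..a} v \<le> (\<integral>t. a * indicator {..a} t \<partial>M v)"
    unfolding T'_Q_inner[OF borel_closed[OF closed_atMost]]
  proof (rule integral_mono)
    show "integrable (M v) (\<lambda>t. indicator {..a} t * t)" by (rule integrable_indicator_M) simp
    show "integrable (M v) (\<lambda>t. a * indicator {..a} t)" by (simp add: emeasure_M)
  qed (simp add: indicator_def)
  then show ?thesis by (simp add: measure_M)
qed

lemma T'_Q_lower: "b * (norm (Q {b<..} v))\<^sup>2 \<le> T' (Q {b<..} v) \<bullet> Q {b<..} v"
proof -
  interpret finite_measure "M v" by (rule finite_measure_M)
  have "(\<integral>t. b * indicator {b<..} t \<partial>M v) \<le> T' (Q {b<..} v) \<bullet> Q {b<..} v"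
    unfolding T'_Q_inner[OF borel_open[OF open_greaterThan]]
  proof (rule integral_mono)
    show "integrable (M v) (\<lambda>t. indicator {b<..} t * t)" by (rule integrable_indicator_M) simp
    show "integrable (M v) (\<lambda>t. b * indicator {b<..} t)" by (simp add: emeasure_M)
  qed (simp add: indicator_def)
  then show ?thesis by (simp add: measure_M)
qed

lemma Q_atMost_add_greaterThan: "Q {..a} v + Q {a<..} v = l2_restrict X v"
  using Q_compl[of "{..a}" v] by (simp add: Compl_atMost)

text \<open>The energy has no cross terms, since T' commutes with the projections. The part above
  \<open>a\<close> has energy at least \<open>a\<close> times its squared norm, so it carries at
  most half of ||v||^2.\<close>

lemma Q_markov:
  assumes a: "0 < a" and v: "T' v \<bullet> v \<le> a / 2 * (norm v)\<^sup>2" "l2_restrict X v = v"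
  shows "(norm v)\<^sup>2 \<le> 2 * (norm (Q {..a} v))\<^sup>2"
proof -
  let ?E = "Q {a<..} v" and ?F = "Q {..a} v"
  have B: "{a<..} \<in> sets borel" "{..a} \<in> sets borel" by auto
  have sum: "?F + ?E = v" using Q_atMost_add_greaterThan[of a v] v(2) by simp
  have "{..a} \<inter> {a<..} = {}" by auto
  then have QE: "Q {..a} ?E = 0"
    using Q_Int[OF B(2,1), of v] by (simp add: Q_empty)
  have orth: "?F \<bullet> ?E = 0" by (simp add: Q_sym[OF B(2)] QE)
  have "T' ?F \<bullet> ?E = 0" by (simp add: T'_Q_commute[OF B(2)] Q_sym[OF B(2)] QE)
  moreover have "T' ?E \<bullet> ?F = T' ?F \<bullet> ?E" by (subst T'_sym) (rule inner_commute)
  ultimately have "T' (?F + ?E) \<bullet> (?F + ?E) = T' ?F \<bullet> ?F + T' ?E \<bullet> ?E"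
    by (simp add: linear_add[OF linear_T'] inner_add)
  then have "T' v \<bullet> v = T' ?F \<bullet> ?F + T' ?E \<bullet> ?E" by (simp only: sum)
  then have "a * (norm ?E)\<^sup>2 \<le> a / 2 * (norm v)\<^sup>2"
    using T'_Q_lower[of a v] T'_nonneg[of ?F] v(1) by linarith
  then have "2 * (norm ?E)\<^sup>2 \<le> (norm v)\<^sup>2" using a by simp
  moreover have "(norm (?F + ?E))\<^sup>2 = (norm ?F)\<^sup>2 + (norm ?E)\<^sup>2"
    by (simp add: power2_norm_eq_inner inner_add orth inner_commute[of ?E ?F])
  then have "(norm v)\<^sup>2 = (norm ?F)\<^sup>2 + (norm ?E)\<^sup>2" by (simp only: sum)
  ultimately show ?thesis by linarith
qed

text \<open>J passes from T' to the projections through the growth of iterates: at most a^n on the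
  range of \<open>Q {..a}\<close>, preserved by J, against at least b^n for a nonzero component
  above \<open>b\<close>.\<close>

lemma Q_transport:
  assumes ab: "0 \<le> a" "a < b"
    and J: "\<And>f. J (T' f) = T' (J f)" "\<And>f. norm (J f) \<le> norm f" "\<And>f. l2_restrict X (J f) = J f"
  shows "Q {..b} (J (Q {..a} v)) = J (Q {..a} v)"
proof -
  let ?h = "J (Q {..a} v)"
  have B: "{b<..} \<in> sets borel" "{..a} \<in> sets borel" by auto
  have "norm ((T' ^^ n) ?h) \<le> norm (Q {..a} v) * a ^ n" for n
  proof -
    have "(T' ^^ n) ?h = J ((T' ^^ n) (Q {..a} v))"
      by (induction n) (simp_all add: J(1))
    then have "norm ((T' ^^ n) ?h) \<le> norm ((T' ^^ n) (Q {..a} v))" by (simp add: J(2))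
    also have "\<dots> \<le> a ^ n * norm (Q {..a} v)"
      by (rule norm_funpow_le[OF linear_T' T'_sym T'_nonneg T'_Q_commute[OF B(2)] Q_idem[OF B(2)] T'_Q_upper ab(1)])
    finally show ?thesis by (simp add: mult.commute)
  qed
  then have "Q {b<..} ?h = 0"
    by (rule spectral_part_eq_0_of_growth[OF Q_sym[OF B(1)] Q_idem[OF B(1)] T'_Q_commute[OF B(1)] T'_Q_lower ab])
  then show ?thesis using Q_atMost_add_greaterThan[of b ?h] J(3) by simp
qed

end

section \<open>The lower bound\<close>

lemma point_mass_ell2:
  assumes "y \<in> X"
  shows "point_mass y \<in> ell2 X"
proof -
  have "(\<lambda>x. (cmod (point_mass y x))\<^sup>2) summable_on {y}" by simp
  also have "?this \<longleftrightarrow> (\<lambda>x. (cmod (point_mass y x))\<^sup>2) summable_on X"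
    using assms by (intro summable_on_cong_neutral) (auto simp: point_mass_def)
  finally show ?thesis using assms by (auto simp: ell2_def point_mass_def)
qed

lemma ell2_norm_Abs:
  assumes f: "f \<in> ell2 X"
  shows "ell2_norm X f = norm (Abs_l2 f)"
proof -
  have "ell2_norm X f = ell2_norm UNIV f"
    unfolding ell2_norm_def using f
    by (intro arg_cong[where f=sqrt] infsum_cong_neutral) (auto simp: ell2_def)
  then show ?thesis using ell2_norm_l2_fun[of "Abs_l2 f"] l2_restrict_Abs(1)[OF f] by simp
qed

lemma Abs_l2_eq_0_iff:
  assumes f: "f \<in> ell2 X"
  shows "Abs_l2 f = 0 \<longleftrightarrow> f = (\<lambda>_. 0)"
proof -
  have "Abs_l2 f = 0 \<longleftrightarrow> l2_fun (Abs_l2 f) = l2_fun 0" by (simp add: l2_fun_inject)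
  then show ?thesis by (simp add: l2_restrict_Abs(1)[OF f] fun_eq_iff)
qed

abbreviation l2_delta :: "'a \<Rightarrow> 'a l2" where
  "l2_delta y \<equiv> Abs_l2 (point_mass y)"

lemma l2_fun_delta: "l2_fun (l2_delta y) = point_mass y"
  using point_mass_ell2[of y UNIV] by simp

lemma inner_scaleC_delta: "v \<bullet> l2_scaleC c (l2_delta y) = Re (l2_fun v y * cnj c)"
proof -
  have "v \<bullet> l2_scaleC c (l2_delta y) = (\<Sum>\<^sub>\<infinity>x\<in>{y}. Re (l2_fun v x * cnj c))"
    unfolding inner_l2_infsum l2_fun_scaleC l2_fun_delta
    by (intro infsum_cong_neutral) (auto simp: point_mass_def)
  then show ?thesis by simp
qed

lemma inner_delta: "v \<bullet> l2_delta y = Re (l2_fun v y)"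
proof -
  have "l2_delta y = l2_scaleC 1 (l2_delta y)" by (rule l2_eqI) simp
  then show ?thesis using inner_scaleC_delta[of v 1 y] by simp
qed

context symmetric_generating_set
begin

lemma lap_of_restr: "lap (restr f) = lap f" and restr_of_lap: "restr (lap f) = lap f"
proof -
  show "restr (lap f) = lap f"
    by (rule l2_eqI) (simp add: l2_fun_lap l2_fun_pullback[OF bij_betw_ident])
  then show "lap (restr f) = lap f" by (simp add: lap_restr)
qed

text \<open>The very choice made in \<open>spectral_projection\<close>, named so that the general
  facts apply to it.\<close>

definition laplace_measure :: "real set \<Rightarrow> ('a \<Rightarrow> complex) \<Rightarrow> 'a \<Rightarrow> complex" where
  "laplace_measure = (SOME P. is_spectral_measure (carrier G) (laplace G S) P)"

sublocale l2_spectral_measure "carrier G" "laplace G S" laplace_measure lap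
proof (rule l2_spectral_measure.intro)
  show "is_spectral_measure (carrier G) (laplace G S) laplace_measure"
    unfolding laplace_measure_def by (rule someI_ex[OF spectral_measure_laplace_exists])
qed (fact laplace_eq_lap linear_lap lap_sym lap_bounds(1) lap_of_restr restr_of_lap)+

lemma spectral_distribution_eq: "spectral_distribution G S t = (norm (Q {..t} (l2_delta \<one>)))\<^sup>2"
proof -
  have "restr (l2_delta \<one>) = l2_delta \<one>" by (simp add: l2_restrict_Abs point_mass_ell2)
  then have "spectral_distribution G S t = Q {..t} (l2_delta \<one>) \<bullet> l2_delta \<one>"
    unfolding spectral_distribution_def spectral_projection_def laplace_measure_def[symmetric]
    by (simp add: Q_inner l2_fun_delta)
  then show ?thesis by (simp add: Q_inner_self)
qed

text \<open>For u = Q {..a} (l2_delta y), ||u||^2 is the real part of u(y), which is the value at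
  the identity of the translate h. As h is fixed by \<open>Q {..b}\<close>, it is paired with Q
  {..b} (l2_delta 1), and Cauchy-Schwarz leaves one factor ||u|| to cancel.\<close>

lemma norm_Q_delta_le:
  assumes y: "y \<in> carrier G" and ab: "0 \<le> a" "a < b"
  shows "norm (Q {..a} (l2_delta y)) \<le> norm (Q {..b} (l2_delta \<one>))"
proof -
  let ?u = "Q {..a} (l2_delta y)"
  let ?h = "left_translation y ?u"
  note L = l2_fun_pullback[OF bij_left[OF y]]
  have "Q {..b} ?h = ?h"
  proof (rule Q_transport[OF ab])
    show "restr (left_translation y f) = left_translation y f" for f
      by (rule l2_eqI) (simp add: L l2_fun_pullback[OF bij_betw_ident])
  qed (use y in \<open>simp_all add: lap_left_translation norm_l2_pullback_le bij_left\<close>)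
  have "(norm ?u)\<^sup>2 = Re (l2_fun ?u y)" by (simp add: inner_delta flip: Q_inner_self)
  also have "\<dots> = ?h \<bullet> l2_delta \<one>" using y by (simp add: inner_delta L)
  also have "\<dots> = Q {..b} ?h \<bullet> l2_delta \<one>" by (simp add: \<open>Q {..b} ?h = ?h\<close>)
  also have "\<dots> = ?h \<bullet> Q {..b} (l2_delta \<one>)" by (simp add: Q_sym)
  also have "\<dots> \<le> norm ?h * norm (Q {..b} (l2_delta \<one>))" by (rule norm_cauchy_schwarz)
  also have "\<dots> \<le> norm ?u * norm (Q {..b} (l2_delta \<one>))"
    by (intro mult_right_mono norm_l2_pullback_le bij_left y) simp
  finally show ?thesis by (cases "?u = 0") (simp_all add: power2_eq_square)
qed

theorem spectral_distribution_lower_bound: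
  assumes f: "f \<in> ell2 (carrier G)" "f \<noteq> (\<lambda>_. 0)" "{x. f x \<noteq> 0} \<subseteq> \<Omega>"
    and \<Omega>: "finite \<Omega>" "\<Omega> \<subseteq> carrier G"
    and energy: "Re (ell2_inner (carrier G) (laplace G S f) f) \<le> a / 2 * (ell2_norm (carrier G) f)\<^sup>2"
    and ab: "0 < a" "a < b"
  shows "1 \<le> 2 * real (card \<Omega>) * spectral_distribution G S b"
proof -
  let ?v = "Abs_l2 f"
  let ?u = "Q {..a} ?v"
  define K where "K = norm (Q {..b} (l2_delta \<one>))"
  note fv = l2_restrict_Abs[OF f(1)]
  have "laplace G S f \<in> ell2 (carrier G)"
    using restr_of_lap[of ?v] by (simp add: laplace_eq_lap[OF f(1)] l2_restrict_eq_iff)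
  then have "Re (ell2_inner (carrier G) (laplace G S f) f) = lap ?v \<bullet> ?v"
    using f(1) by (simp add: ell2_inner_Abs laplace_eq_lap l2_fun_inverse)
  then have markov: "(norm ?v)\<^sup>2 \<le> 2 * (norm ?u)\<^sup>2"
    using energy ab fv by (intro Q_markov) (auto simp: ell2_norm_Abs[OF f(1)])
  have "?v \<noteq> 0" using f(2) by (simp add: Abs_l2_eq_0_iff[OF f(1)])
  have "?v = (\<Sum>x\<in>\<Omega>. l2_scaleC (f x) (l2_delta x))"
  proof (rule l2_eqI)
    fix x
    have "l2_fun (\<Sum>y\<in>\<Omega>. l2_scaleC (f y) (l2_delta y)) x = (\<Sum>y\<in>\<Omega>. if y = x then f y else 0)"
      unfolding l2_fun_sum l2_fun_scaleC l2_fun_delta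
      by (intro sum.cong) (auto simp: point_mass_def)
    also have "\<dots> = f x" using \<Omega>(1) f(3) by auto
    finally show "l2_fun ?v x = l2_fun (\<Sum>x\<in>\<Omega>. l2_scaleC (f x) (l2_delta x)) x" using fv by simp
  qed
  then have "?u \<bullet> ?v = (\<Sum>x\<in>\<Omega>. ?u \<bullet> l2_scaleC (f x) (l2_delta x))"
    by (metis inner_sum_right)
  also have "\<dots> \<le> (\<Sum>x\<in>\<Omega>. norm ?u * (cmod (f x) * K))"
  proof (rule sum_mono)
    fix x assume "x \<in> \<Omega>"
    \<comment> \<open>?u lies in the range of the projection, which can therefore be moved onto the
      point mass, where its norm is at most K.\<close>
    have "?u \<bullet> l2_scaleC (f x) (l2_delta x) = ?u \<bullet> l2_scaleC (f x) (Q {..a} (l2_delta x))"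
      using Q_sym[of "{..a}" ?u "l2_scaleC (f x) (l2_delta x)"] by (simp add: Q_idem Q_scaleC)
    also have "\<dots> \<le> norm ?u * (cmod (f x) * norm (Q {..a} (l2_delta x)))"
      using norm_cauchy_schwarz[of ?u "l2_scaleC (f x) (Q {..a} (l2_delta x))"] by simp
    also have "\<dots> \<le> norm ?u * (cmod (f x) * K)"
      unfolding K_def using \<open>x \<in> \<Omega>\<close> \<Omega>(2) ab by (intro mult_left_mono norm_Q_delta_le) auto
    finally show "?u \<bullet> l2_scaleC (f x) (l2_delta x) \<le> norm ?u * (cmod (f x) * K)" .
  qed
  also have "\<dots> = norm ?u * (K * (\<Sum>x\<in>\<Omega>. cmod (f x)))"
    by (simp add: sum_distrib_left sum_distrib_right mult_ac)
  finally have "(norm ?u)\<^sup>2 \<le> norm ?u * (K * (\<Sum>x\<in>\<Omega>. cmod (f x)))"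
    by (simp add: Q_inner_self)
  moreover have "?u \<noteq> 0" using markov \<open>?v \<noteq> 0\<close> by auto
  ultimately have "norm ?u \<le> K * (\<Sum>x\<in>\<Omega>. cmod (f x))" by (simp add: power2_eq_square)
  then have "(norm ?u)\<^sup>2 \<le> K\<^sup>2 * (\<Sum>x\<in>\<Omega>. cmod (f x))\<^sup>2"
    unfolding power_mult_distrib[symmetric] by (rule power_mono) simp
  also have "\<dots> \<le> K\<^sup>2 * (real (card \<Omega>) * (norm ?v)\<^sup>2)"
  proof (rule mult_left_mono)
    have "(\<Sum>x\<in>\<Omega>. cmod (f x))\<^sup>2 \<le> (\<Sum>x\<in>\<Omega>. (cmod (f x))\<^sup>2) * real (card \<Omega>)"
      by (rule sum_squared_le_sum_of_squares)
    also have "\<dots> \<le> (norm ?v)\<^sup>2 * real (card \<Omega>)"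
      using sum_cmod_square_le_norm[OF \<Omega>(1), of ?v] fv by (intro mult_right_mono) auto
    finally show "(\<Sum>x\<in>\<Omega>. cmod (f x))\<^sup>2 \<le> real (card \<Omega>) * (norm ?v)\<^sup>2" by (simp add: mult.commute)
  qed simp
  finally have "(norm ?v)\<^sup>2 \<le> 2 * (K\<^sup>2 * (real (card \<Omega>) * (norm ?v)\<^sup>2))"
    using markov by linarith
  also have "\<dots> = (2 * real (card \<Omega>) * K\<^sup>2) * (norm ?v)\<^sup>2" by simp
  finally have "1 * (norm ?v)\<^sup>2 \<le> (2 * real (card \<Omega>) * K\<^sup>2) * (norm ?v)\<^sup>2" by simp
  moreover have "0 < (norm ?v)\<^sup>2" using \<open>?v \<noteq> 0\<close> by simp
  ultimately show ?thesis
    unfolding spectral_distribution_eq K_def[symmetric] by (rule mult_right_le_imp_le)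
qed

text \<open>The infimum may fail to be attained, hence the strict bound \<kappa>, which supplies a
  test function. Then a = 2 \<kappa> absorbs the 1/2 in the energy hypothesis, and b = 4 \<kappa> is
  a convenient value above a.\<close>

lemma spectral_distribution_lambda1:
  assumes \<Omega>: "finite \<Omega>" "\<Omega> \<noteq> {}" "\<Omega> \<subseteq> carrier G"
    and \<kappa>: "lambda1 G S \<Omega> < \<kappa>" "0 < \<kappa>"
  shows "1 \<le> 2 * real (card \<Omega>) * spectral_distribution G S (4 * \<kappa>)"
proof -
  let ?R = "{Re (ell2_inner (carrier G) (laplace G S f) f) / (ell2_norm (carrier G) f)\<^sup>2 | f.
            f \<in> ell2 (carrier G) \<and> {x. f x \<noteq> 0} \<noteq> {} \<and> {x. f x \<noteq> 0} \<subseteq> \<Omega>}"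
  obtain y where y: "y \<in> \<Omega>" using \<Omega> by blast
  \<comment> \<open>A point mass shows that the set of quotients is nonempty, as
    \<open>cInf_lessD\<close> requires.\<close>
  have "point_mass y \<in> ell2 (carrier G) \<and> {x. point_mass y x \<noteq> 0} \<noteq> {} \<and> {x. point_mass y x \<noteq> 0} \<subseteq> \<Omega>"
    using y \<Omega> point_mass_ell2[of y "carrier G"] by (auto simp: point_mass_def)
  then have "?R \<noteq> {}" by blast
  moreover have "Inf ?R < \<kappa>" using \<kappa>(1) by (simp add: lambda1_def)
  ultimately obtain f where f: "f \<in> ell2 (carrier G)" "{x. f x \<noteq> 0} \<noteq> {}" "{x. f x \<noteq> 0} \<subseteq> \<Omega>"
      and less: "Re (ell2_inner (carrier G) (laplace G S f) f) / (ell2_norm (carrier G) f)\<^sup>2 < \<kappa>"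
    using cInf_lessD[of ?R \<kappa>] by blast
  have energy: "Re (ell2_inner (carrier G) (laplace G S f) f) \<le> \<kappa> * (ell2_norm (carrier G) f)\<^sup>2"
  proof -
    have "f \<noteq> (\<lambda>_. 0)" using f(2) by auto
    then have "0 < (ell2_norm (carrier G) f)\<^sup>2"
      by (simp add: ell2_norm_Abs[OF f(1)] Abs_l2_eq_0_iff[OF f(1)])
    then show ?thesis using less by (simp add: divide_less_eq)
  qed
  show ?thesis
  proof (rule spectral_distribution_lower_bound[OF f(1) _ f(3) \<Omega>(1,3), of "2 * \<kappa>"])
    show "f \<noteq> (\<lambda>_. 0)" using f(2) by auto
  qed (use energy \<kappa> in auto)
qed

end

lemma piecewise_linear_ge:
  assumes "a (nat \<lfloor>r\<rfloor>) \<le> a (Suc (nat \<lfloor>r\<rfloor>))" "0 \<le> r"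
  shows "a (nat \<lfloor>r\<rfloor>) \<le> piecewise_linear a r"
  using assms by (simp add: piecewise_linear_def Let_def)

theorem proposition4p3:
  fixes G :: "('a, 'b) monoid_scheme" and S :: "'a set"
    and \<Omega> :: "nat \<Rightarrow> 'a set" and F :: "real \<Rightarrow> real"
  defines "F \<equiv> piecewise_linear (\<lambda>n. real (card (\<Omega> n)))"
  assumes "group G"
    and "finite S" "S \<noteq> {}" "S \<subseteq> carrier G" "generate G S = carrier G"
    and "\<forall>s\<in>S. inv\<^bsub>G\<^esub> s \<in> S"
    and "\<forall>n\<ge>1. finite (\<Omega> n) \<and> \<Omega> n \<noteq> {} \<and> \<Omega> n \<subseteq> carrier G"
    and "\<exists>\<alpha>\<ge>1. \<forall>n\<ge>1. lambda1 G S (\<Omega> n) \<le> \<alpha> / (real n)\<^sup>2"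
    and "\<forall>n\<ge>1. card (\<Omega> n) < card (\<Omega> (Suc n))"
    and "\<exists>C>1. \<forall>\<^sub>F r in at_top. F (C * r) \<ge> (F r)\<^sup>2"
  shows "succeq_near_zero (spectral_distribution G S)
           (\<lambda>t. if t = 0 then 0 else 1 / F (t powr (-1/2)))"
proof -
  interpret symmetric_generating_set G S
    using assms by (intro symmetric_generating_set.intro symmetric_generating_set_axioms.intro) auto
  obtain \<alpha> where \<alpha>: "1 \<le> \<alpha>" "\<And>n. 1 \<le> n \<Longrightarrow> lambda1 G S (\<Omega> n) \<le> \<alpha> / (real n)\<^sup>2"
    using assms by blast
  have bound: "1 / F (t powr (-1/2)) \<le> 2 * spectral_distribution G S (16 * \<alpha> * t)"
    if t: "0 < t" "t < 1" for t
  proof -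
    define r where "r = t powr (-1/2)"
    have "1 \<le> r" using t by (simp add: r_def ge_one_powr_ge_zero powr_minus one_le_inverse_iff powr_le1)
    define n where "n = nat \<lfloor>r\<rfloor>"
    have n: "1 \<le> n" "r < real n + 1" using \<open>1 \<le> r\<close> by (auto simp: n_def le_nat_iff)
    have "t * r\<^sup>2 = 1" using t by (simp add: r_def powr_minus powr_half_sqrt power_inverse)
    \<comment> \<open>From n >= 1, r < n + 1 <= 2n. With t r^2 = 1 this becomes 1 / n^2 < 4t, so 4
      \<alpha> t lies strictly above the bound on \<open>lambda1\<close>.\<close>
    moreover have "r < 2 * real n" using n by linarith
    then have "r\<^sup>2 < (2 * real n)\<^sup>2" using \<open>1 \<le> r\<close> by (intro power_strict_mono) auto
    ultimately have "1 < t * (2 * real n)\<^sup>2" using t(1) by (metis mult_strict_left_mono)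
    then have "\<alpha> / (real n)\<^sup>2 < 4 * \<alpha> * t"
      using n \<alpha>(1) by (simp add: divide_less_eq power_mult_distrib mult.commute mult.left_commute)
    then have "1 \<le> 2 * real (card (\<Omega> n)) * spectral_distribution G S (4 * (4 * \<alpha> * t))"
      using assms(8) n \<alpha>(1) \<alpha>(2)[OF n(1)] t(1) by (intro spectral_distribution_lambda1) auto
    moreover have card: "0 < real (card (\<Omega> n))"
      using assms(8) n by (simp add: card_gt_0_iff)
    ultimately have "1 / real (card (\<Omega> n)) \<le> 2 * spectral_distribution G S (16 * \<alpha> * t)"
      by (simp add: divide_le_eq mult.commute mult.left_commute)
    moreover have "real (card (\<Omega> n)) \<le> F r"
      unfolding F_def n_def using assms(10) n(1) \<open>1 \<le> r\<close>
      by (intro piecewise_linear_ge) (auto simp: n_def less_imp_le)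
    then have "1 / F r \<le> 1 / real (card (\<Omega> n))" using card by (intro divide_left_mono) auto
    ultimately show ?thesis by (simp add: r_def)
  qed
  \<comment> \<open>At t = 0 the left side is 0 by convention and the right side is twice a squared
    norm.\<close>
  have "(if t = 0 then 0 else 1 / F (t powr (-1/2))) \<le> 2 * spectral_distribution G S (16 * \<alpha> * t)"
    if "t \<in> {0..<1}" for t
    using bound[of t] that by (auto simp: spectral_distribution_eq)
  then show ?thesis
    unfolding succeq_near_zero_def preceq_near_zero_def using \<alpha>(1)
    by (intro exI[of _ 2] exI[of _ "16 * \<alpha>"] exI[of _ 1] conjI) auto
qed

end
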